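(* (i) For any partition $\lambda=(\lambda_1,\dots,\lambda_k)$, $$Y_{\lambda_1}^*Y_{\lambda_2}^*\cdots Y_{\lambda_k}^*.1=(-1)^{|\lambda|}\det\big(e_{\lambda_i-i+j}-e_{\lambda_i-i-j}\big)_{1\le i,j\le k}.$$ (ii) Consequently, for any partition $\lambda$ and its conjugate $\lambda'$, $$sp_\lambda=\frac12\det\big(h_{\lambda_i-i+j}+h_{\lambda_i-i-j+2}\big)=\det\big(e_{\lambda_i'-i+j}-e_{\lambda_i'-i-j}\big),$$ where the first determinant has size the number of entries of $\lambda$ and the second has size the number of entries of $\lambda'$. (iii) Moreover, for any partition $(\alpha|\beta)=(\alpha_1\cdots\alpha_r|\beta_1\cdots\beta_r)$ in Frobenius notation, with $|\beta|=\sum_i\beta_i$, $$sp_{(\alpha|\beta)}=(-1)^{|\beta|+r(r-1)/2}\,Y_{-\alpha_1-1}\cdots Y_{-\alpha_r-r}\,Y_{\beta_1-(r-1)}^*Y_{\beta_2-(r-2)}^*\cdots Y_{\beta_r}^*.1,$$ $$sp_{(\alpha|\beta)}=(-1)^{|\beta|+r}\,Y_{\beta_1-1}^*\cdots Y_{\beta_r-r}^*\,Y_{-\alpha_1+(r-1)}\cdots Y_{-\alpha_r}.1.$$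
   Context: $\Lambda=\Lambda_{\mathbb Q}=\mathbb Q[p_1,p_2,\dots]$ is the ring of symmetric functions over $\mathbb Q$ in countably many variables, where $p_n=\sum_i x_i^n$ are the power sums. The complete homogeneous and elementary symmetric functions are given by $\sum_{n\ge0}h_nz^n=\exp(\sum_{n\ge1}\frac{p_n}{n}z^n)$ and $\sum_{n\ge0}e_nz^n=\exp(-\sum_{n\ge1}\frac{p_n}{n}(-z)^n)$, with $h_n=e_n=0$ for $n<0$. Partitions are written $\lambda=(\lambda_1\ge\dots\ge\lambda_k\ge0)$ with $k\ge1$, and $|\lambda|=\sum_i\lambda_i$. The conjugate $\lambda'$ is obtained by reflecting the Young diagram of $\lambda$ along its main diagonal. The symplectic Schur function is by definition $sp_\lambda=\frac12\det(h_{\lambda_i-i+j}+h_{\lambda_i-i-j+2})_{1\le i,j\le k}$. Frobenius notation: if $r$ is the length of the main diagonal of the Young diagram of $\lambda$, then $\lambda=(\alpha_1\cdots\alpha_r|\beta_1\cdots\beta_r)$ with $\alpha_i=\lambda_i-i$, $\beta_i=\lambda'_i-i$ for $1\le i\le r$. The operators $Y_n,Y_n^*$ ($n\in\mathbb Z$) on $\Lambda$ are the coefficients of the vertex operators $\Lambda\to\Lambda[[z,z^{-1}]]$ $$Y(z)=\exp\Big(\sum_{n\ge1}\frac{p_n}{n}z^n\Big)\exp\Big(-\sum_{n\ge1}\frac{\partial}{\partial p_n}(z^{-n}+z^n)\Big)=\sum_{n\in\mathbb Z}Y_nz^{-n},$$ $$Y^*(z)=(1-z^2)\exp\Big(-\sum_{n\ge1}\frac{p_n}{n}z^n\Big)\exp\Big(\sum_{n\ge1}\frac{\partial}{\partial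 p_n}(z^{-n}+z^n)\Big)=\sum_{n\in\mathbb Z}Y^*_nz^{n},$$ where $p_n$ acts by multiplication. "$.1$" means applying an operator to $1\in\Lambda$.
   Formalization: The last formula of (iii) is false as printed (λ=(1) gives 0 instead of h_1; it fails for all r≥1); it is proved with Y*_{β_i+i} in place of Y*_{β_i−i} and with sign (−1)^{|β|+r(r+1)/2} in place of (−1)^{|β|+r}. *)

theory Defs
  imports
    "HOL-Library.Poly_Mapping"
    "HOL-Computational_Algebra.Formal_Laurent_Series"
    "Jordan_Normal_Form.Determinant"
begin

(* The polynomial ring Q[p_1, p_2, ...]: finitely supported functions from monomials (exponent
   vectors) to coefficients. The variable with index i is p_(i+1). *)
type_synonym symfun = "(nat \<Rightarrow>\<^sub>0 nat) \<Rightarrow>\<^sub>0 rat"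

definition sf_const :: "rat \<Rightarrow> symfun" where
  "sf_const c = Poly_Mapping.single 0 c"

(* p_n, meaningful for n >= 1 only; likewise for sf_deriv. *)
definition psum :: "nat \<Rightarrow> symfun" where
  "psum n = Poly_Mapping.single (Poly_Mapping.single (n - 1) 1) 1"

(* The partial derivative with respect to p_n. The truncated subtraction of exponents is harmless:
   a monomial without p_n gets the coefficient 0. *)
definition sf_deriv :: "nat \<Rightarrow> symfun \<Rightarrow> symfun" where
  "sf_deriv n f = (\<Sum>m\<in>Poly_Mapping.keys f.
     Poly_Mapping.single (m - Poly_Mapping.single (n - 1) 1)
       (Poly_Mapping.lookup f m * of_nat (Poly_Mapping.lookup m (n - 1))))"

(* exp F for a power series F without constant term. The library's fps_exp is only available over
   fields of characteristic 0. *)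
definition sf_fps_exp :: "symfun fps \<Rightarrow> symfun fps" where
  "sf_fps_exp F = fps_compose (Abs_fps (\<lambda>n. sf_const (1 / fact n))) F"

(* Sum over n >= 1 of p_n z^n / n. *)
definition psum_series :: "symfun fps" where
  "psum_series = Abs_fps (\<lambda>n. if n = 0 then 0 else sf_const (1 / of_nat n) * psum n)"

definition hsym :: "int \<Rightarrow> symfun" where
  "hsym n = (if n < 0 then 0 else fps_nth (sf_fps_exp psum_series) (nat n))"

definition esym :: "int \<Rightarrow> symfun" where
  "esym n = (if n < 0 then 0 else
     fps_nth (sf_fps_exp (- Abs_fps (\<lambda>m. if m = 0 then 0
                               else sf_const ((-1) ^ m / of_nat m) * psum m))) (nat n))"

(* Laurent polynomials in z over symfun, where Poly_Mapping.single m f is f z^m. *)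
type_synonym laurent_poly = "int \<Rightarrow>\<^sub>0 symfun"

(* Sum over n >= 1 of (d/dp_n) (z^(-n) + z^n), z-linear in F. Only finitely many p_n occur in F,
   so the Sum_any is a genuine finite sum. *)
definition vertex_deriv :: "laurent_poly \<Rightarrow> laurent_poly" where
  "vertex_deriv F = Sum_any (\<lambda>i::nat.
     Poly_Mapping.map (sf_deriv (Suc i)) F *
     (Poly_Mapping.single (- int (Suc i)) 1 + Poly_Mapping.single (int (Suc i)) 1))"

(* exp T F for a locally nilpotent operator T, so that again the Sum_any is a finite sum. *)
definition op_exp :: "(laurent_poly \<Rightarrow> laurent_poly) \<Rightarrow> laurent_poly \<Rightarrow> laurent_poly" where
  "op_exp T F = Sum_any (\<lambda>k::nat.
     Poly_Mapping.single 0 (sf_const (1 / fact k)) * (T ^^ k) F)"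

definition laurent_poly_to_fls :: "laurent_poly \<Rightarrow> symfun fls" where
  "laurent_poly_to_fls F = (\<Sum>m\<in>Poly_Mapping.keys F.
     fls_const (Poly_Mapping.lookup F m) * fls_X_intpow m)"

(* Y(z) f and Y*(z) f. The derivative factor sends f to a Laurent polynomial in z, hence the series
   in z and z^(-1) obtained from a fixed f are Laurent series, with only finitely many negative
   powers of z. *)
definition Y_gen :: "symfun \<Rightarrow> symfun fls" where
  "Y_gen f = fps_to_fls (sf_fps_exp psum_series) *
     laurent_poly_to_fls (op_exp (\<lambda>F. - vertex_deriv F) (Poly_Mapping.single 0 f))"

definition Ystar_gen :: "symfun \<Rightarrow> symfun fls" where
  "Ystar_gen f = (1 - fls_X ^ 2) * fps_to_fls (sf_fps_exp (- psum_series)) *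
     laurent_poly_to_fls (op_exp vertex_deriv (Poly_Mapping.single 0 f))"

(* Y(z) is expanded in powers of z^(-1), Y*(z) in powers of z. *)
definition Y :: "int \<Rightarrow> symfun \<Rightarrow> symfun" where
  "Y n f = fls_nth (Y_gen f) (- n)"

definition Ystar :: "int \<Rightarrow> symfun \<Rightarrow> symfun" where
  "Ystar n f = fls_nth (Ystar_gen f) n"

(* Trailing zeros are allowed, and there is at least one entry. *)
definition is_partition :: "nat list \<Rightarrow> bool" where
  "is_partition lam \<longleftrightarrow> lam \<noteq> [] \<and> sorted_wrt (\<ge>) lam"

(* Rows and columns are counted from 0. *)
definition diagram :: "nat list \<Rightarrow> (nat \<times> nat) set" where
  "diagram lam = {(i, j). i < length lam \<and> j < lam ! i}"

(* The conjugate is determined up to trailing zeros. *)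
definition is_conjugate :: "nat list \<Rightarrow> nat list \<Rightarrow> bool" where
  "is_conjugate lam mu \<longleftrightarrow> is_partition mu \<and> diagram mu = (diagram lam)\<inverse>"

definition diag_length :: "nat list \<Rightarrow> nat" where
  "diag_length lam = card {i. (i, i) \<in> diagram lam}"

(* lam = (alpha | beta) in Frobenius notation. For i < diag_length lam, both lam ! i and mu ! i
   are at least Suc i, so the subtractions are not truncated. *)
definition frobenius :: "nat list \<Rightarrow> nat list \<Rightarrow> nat list \<Rightarrow> bool" where
  "frobenius lam alpha beta \<longleftrightarrow> (\<exists>mu. is_conjugate lam mu \<and>
     alpha = map (\<lambda>i. lam ! i - Suc i) [0..<diag_length lam] \<and>
     beta = map (\<lambda>i. mu ! i - Suc i) [0..<diag_length lam])"

(* Matrix rows and columns are indexed from 0, so the indices lam_i - i - j + 2 and lam_i - i - j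
   for i, j >= 1 become lam ! i - i - j and lam ! i - i - j - 2. *)
definition sp :: "nat list \<Rightarrow> symfun" where
  "sp lam = sf_const (1 / 2) * det (mat (length lam) (length lam)
     (\<lambda>(i, j). hsym (int (lam ! i) - int i + int j) + hsym (int (lam ! i) - int i - int j)))"

definition e_det :: "nat list \<Rightarrow> symfun" where
  "e_det lam = det (mat (length lam) (length lam)
     (\<lambda>(i, j). esym (int (lam ! i) - int i + int j) - esym (int (lam ! i) - int i - int j - 2)))"

end

theory Submission
  imports Defs
begin

text \<open>
  The operator \<open>exp (\<plusminus> \<Sum> \<partial>/\<partial>p\<^sub>n (z\<^sup>n + z\<^sup>-\<^sup>n))\<close> is the ring homomorphism
  \<open>p\<^sub>n \<mapsto> p\<^sub>n \<plusminus> (z\<^sup>n + z\<^sup>-\<^sup>n)\<close>. Hence \<open>Y(z)\<close> and \<open>Y*(z)\<close> act on determinants entrywise, and up to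
  unimodular column operations they prepend a row. This evaluates \<open>Y*\<close> products on 1 and identifies
  \<open>sp\<close> with a product of operators \<open>Y\<close> applied to 1.

  With charges introduced by \<open>\<psi>\<^sub>a = Y\<^sub>c\<^sub>-\<^sub>a\<close> and \<open>\<psi>*\<^sub>a = Y*\<^sub>c\<^sub>-\<^sub>1\<^sub>-\<^sub>a\<close> on charge \<open>c\<close>, the operators
  satisfy the fermionic anticommutation relations. Since \<open>[Y(z), p\<^sub>k] = - (z\<^sup>k + z\<^sup>-\<^sup>k) Y(z)\<close> and
  \<open>[Y*(z), p\<^sub>k] = (z\<^sup>k + z\<^sup>-\<^sup>k) Y*(z)\<close>, these relations need only be checked on 1. Every product in the
  theorem is therefore, up to sign, a wedge indexed by its set of occupied sites, and
  everything reduces to the fact that \<open>{\<lambda>\<^sub>i - i}\<close> and \<open>{j - 1 - \<lambda>'\<^sub>j}\<close> partition an interval.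
\<close>

section \<open>The derivations\<close>

abbreviation zpow :: "int \<Rightarrow> laurent_poly" where
  "zpow m \<equiv> Poly_Mapping.single m 1"

abbreviation zconst :: "symfun \<Rightarrow> laurent_poly" where
  "zconst f \<equiv> Poly_Mapping.single 0 f"

lemma update_eq_add_single:
  fixes f :: "'a \<Rightarrow>\<^sub>0 'b::comm_monoid_add"
  assumes "a \<notin> Poly_Mapping.keys f"
  shows "Poly_Mapping.update a b f = Poly_Mapping.single a b + f"
  using assms by (intro poly_mapping_eqI) (auto simp: lookup_update lookup_add lookup_single when_def in_keys_iff)

lemma psum_times_single:
  "psum (Suc k) * Poly_Mapping.single m c = Poly_Mapping.single (Poly_Mapping.single k 1 + m) c"
  by (simp add: psum_def mult_single)

text \<open>The operators below are controlled by their effect on constants and their commutation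
  with power sums. Induction over these generators therefore proves identities between them.\<close>

lemma symfun_induct [case_names const add mult]:
  assumes const: "\<And>c. P (sf_const c)"
    and add: "\<And>f g. P f \<Longrightarrow> P g \<Longrightarrow> P (f + g)"
    and mult: "\<And>k f. P f \<Longrightarrow> P (psum (Suc k) * f)"
  shows "P f"
proof -
  \<comment> \<open>A monomial is built variable by variable; the inner induction raises the
    exponent of the new one.\<close>
  have mono: "P (Poly_Mapping.single m c)" for m c
  proof (induction m rule: update_induct)
    case const
    show ?case using assms(1)[of c] by (simp add: sf_const_def)
  next
    case (update m a b)
    have "P (Poly_Mapping.single (Poly_Mapping.single a n + m) c)" for n
    proof (induction n)
      case 0
      show ?case using update by simp
    next
      case (Suc n)
      have "Poly_Mapping.single a (Suc n) + m = Poly_Mapping.single a 1 + (Poly_Mapping.single a n + m)"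
        by (simp add: single_add[symmetric] add.assoc[symmetric])
      then show ?case using mult[OF Suc, of a] by (simp add: psum_times_single)
    qed
    then show ?case using update by (simp add: update_eq_add_single)
  qed
  show ?thesis
  proof (induction f rule: update_induct)
    case const
    show ?case using assms(1)[of 0] by (simp add: sf_const_def)
  next
    case (update f a b)
    then show ?case by (simp add: update_eq_add_single add mono)
  qed
qed

text \<open>Truncation lets a monomial \<open>k\<close> without the variable satisfy
  \<open>k - ?e = m\<close> as well, but its factor is then 0. So only \<open>m + ?e\<close>
  contributes.\<close>

lemma lookup_sf_deriv:
  "Poly_Mapping.lookup (sf_deriv (Suc i) f) m
     = Poly_Mapping.lookup f (m + Poly_Mapping.single i 1) * of_nat (Suc (Poly_Mapping.lookup m i))"
proof -
  let ?e = "Poly_Mapping.single i (1::nat)"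
  have *: "(Poly_Mapping.lookup f k * of_nat (Poly_Mapping.lookup k i) when k - ?e = m)
     = (if k = m + ?e then Poly_Mapping.lookup f k * of_nat (Suc (Poly_Mapping.lookup m i)) else 0)" for k
  proof (cases "Poly_Mapping.lookup k i = 0")
    case True
    then have "k \<noteq> m + ?e" by (auto simp: lookup_add lookup_single)
    then show ?thesis using True by simp
  next
    case False
    have "k = k - ?e + ?e"
      by (rule poly_mapping_eqI) (use False in \<open>auto simp: lookup_add lookup_minus lookup_single when_def\<close>)
    then have "k - ?e = m \<longleftrightarrow> k = m + ?e" by (metis add_diff_cancel_right')
    then show ?thesis by (auto simp: lookup_add)
  qed
  have "Poly_Mapping.lookup (sf_deriv (Suc i) f) m =
     (\<Sum>k\<in>Poly_Mapping.keys f. if k = m + ?e then Poly_Mapping.lookup f k * of_nat (Suc (Poly_Mapping.lookup m i)) else 0)"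
    by (simp add: sf_deriv_def lookup_sum lookup_single * del: One_nat_def of_nat_Suc)
  also have "\<dots> = Poly_Mapping.lookup f (m + ?e) * of_nat (Suc (Poly_Mapping.lookup m i))"
    by (auto simp: in_keys_iff)
  finally show ?thesis .
qed

lemma sf_deriv_add: "sf_deriv (Suc i) (f + g) = sf_deriv (Suc i) f + sf_deriv (Suc i) g"
  by (rule poly_mapping_eqI) (simp add: lookup_sf_deriv lookup_add distrib_right del: of_nat_Suc)

lemma sf_deriv_zero [simp]: "sf_deriv (Suc i) 0 = 0"
  by (simp add: sf_deriv_def)

lemma sf_deriv_sf_const [simp]: "sf_deriv (Suc i) (sf_const c) = 0"
  by (auto simp: sf_deriv_def sf_const_def)

lemma sf_deriv_single:
  "sf_deriv (Suc i) (Poly_Mapping.single m c)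
     = Poly_Mapping.single (m - Poly_Mapping.single i 1) (c * of_nat (Poly_Mapping.lookup m i))"
  by (simp add: sf_deriv_def)

lemma sf_deriv_psum_times:
  "sf_deriv (Suc i) (psum (Suc k) * f) = psum (Suc k) * sf_deriv (Suc i) f + (if i = k then f else 0)"
proof (induction f rule: update_induct)
  case const
  then show ?case by simp
next
  case (update f a b)
  let ?e = "\<lambda>i. Poly_Mapping.single i (1::nat)"
  \<comment> \<open>Truncated subtraction can be moved past the addition only when the variable
    occurs in \<open>a\<close>; the other case is treated separately below.\<close>
  have a: "?e k + a - ?e i = ?e k + (a - ?e i)" if "Poly_Mapping.lookup a i \<noteq> 0"
    using that by (intro poly_mapping_eqI) (auto simp: lookup_add lookup_minus lookup_single when_def)
  have s: "sf_deriv (Suc i) (psum (Suc k) * Poly_Mapping.single a b) =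
      psum (Suc k) * sf_deriv (Suc i) (Poly_Mapping.single a b) + (if i = k then Poly_Mapping.single a b else 0)"
  proof (cases "Poly_Mapping.lookup a i = 0")
    case True
    then show ?thesis
      by (simp add: psum_times_single sf_deriv_single lookup_add lookup_single when_def)
  next
    case False
    then have "?e i + (a - ?e i) = a"
      by (intro poly_mapping_eqI) (auto simp: lookup_add lookup_minus lookup_single when_def)
    with a[OF False] show ?thesis
      by (auto simp: psum_times_single sf_deriv_single lookup_add lookup_single distrib_left
          single_add when_def simp del: One_nat_def)
  qed
  show ?case using update
    by (auto simp: update_eq_add_single distrib_left sf_deriv_add s algebra_simps)
qed

lemma finite_sf_deriv: "finite {i. sf_deriv (Suc i) f \<noteq> 0}"
proof (rule finite_subset)
  show "{i. sf_deriv (Suc i) f \<noteq> 0} \<subseteq> (\<Union>m\<in>Poly_Mapping.keys f. Poly_Mapping.keys m)"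
  proof
    fix i assume "i \<in> {i. sf_deriv (Suc i) f \<noteq> 0}"
    then obtain m where "Poly_Mapping.lookup (sf_deriv (Suc i) f) m \<noteq> 0"
      using poly_mapping_eqI[of "sf_deriv (Suc i) f" 0] by auto
    then have "m + Poly_Mapping.single i 1 \<in> Poly_Mapping.keys f"
      by (auto simp: lookup_sf_deriv in_keys_iff)
    moreover have "i \<in> Poly_Mapping.keys (m + Poly_Mapping.single i 1)"
      by (simp add: in_keys_iff lookup_add)
    ultimately show "i \<in> (\<Union>m\<in>Poly_Mapping.keys f. Poly_Mapping.keys m)" by blast
  qed
qed simp

lemma lookup_zconst_times: "Poly_Mapping.lookup (zconst f * F) m = f * Poly_Mapping.lookup F m"
  by (simp add: mult_map_scale_conv_mult[symmetric] Poly_Mapping.map.rep_eq when_def)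

lemma lookup_map_sf_deriv:
  "Poly_Mapping.lookup (Poly_Mapping.map (sf_deriv (Suc i)) F) m = sf_deriv (Suc i) (Poly_Mapping.lookup F m)"
  by (simp add: Poly_Mapping.map.rep_eq when_def)

text \<open>A single summand of \<open>vertex_deriv\<close>, named so that finiteness of its support
  can be stated before a \<open>Sum_any\<close> is manipulated.\<close>

definition vterm :: "laurent_poly \<Rightarrow> nat \<Rightarrow> laurent_poly" where
  "vterm F i = Poly_Mapping.map (sf_deriv (Suc i)) F * (zpow (- int (Suc i)) + zpow (int (Suc i)))"

lemma vertex_deriv_vterm: "vertex_deriv F = Sum_any (vterm F)"
  by (simp add: vertex_deriv_def vterm_def[abs_def])

lemma finite_vterm: "finite {i. vterm F i \<noteq> 0}"
proof (rule finite_subset)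
  show "{i. vterm F i \<noteq> 0} \<subseteq> (\<Union>m\<in>Poly_Mapping.keys F. {i. sf_deriv (Suc i) (Poly_Mapping.lookup F m) \<noteq> 0})"
  proof
    fix i assume "i \<in> {i. vterm F i \<noteq> 0}"
    then have "Poly_Mapping.map (sf_deriv (Suc i)) F \<noteq> 0" by (auto simp: vterm_def)
    then obtain m where "Poly_Mapping.lookup (Poly_Mapping.map (sf_deriv (Suc i)) F) m \<noteq> 0"
      using poly_mapping_eqI[of "Poly_Mapping.map (sf_deriv (Suc i)) F" 0] by auto
    then have "sf_deriv (Suc i) (Poly_Mapping.lookup F m) \<noteq> 0" by (simp add: lookup_map_sf_deriv)
    moreover from this have "m \<in> Poly_Mapping.keys F" by (auto simp: in_keys_iff)
    ultimately show "i \<in> (\<Union>m\<in>Poly_Mapping.keys F. {i. sf_deriv (Suc i) (Poly_Mapping.lookup F m) \<noteq> 0})" by blast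
  qed
qed (use finite_sf_deriv in auto)

lemma vterm_add: "vterm (F + G) i = vterm F i + vterm G i"
proof -
  have "Poly_Mapping.map (sf_deriv (Suc i)) (F + G)
      = Poly_Mapping.map (sf_deriv (Suc i)) F + Poly_Mapping.map (sf_deriv (Suc i)) G"
    by (rule poly_mapping_eqI) (simp add: lookup_map_sf_deriv lookup_add sf_deriv_add)
  then show ?thesis by (simp add: vterm_def distrib_right)
qed

lemma vertex_deriv_add: "vertex_deriv (F + G) = vertex_deriv F + vertex_deriv G"
  by (simp add: vertex_deriv_vterm vterm_add Sum_any.distrib finite_vterm)

text \<open>By the Leibniz rule only the summand \<open>i = k\<close> sees the factor. The
  commutator is thus multiplication by a Laurent polynomial without any power sum, which
  \<open>vertex_deriv\<close> in turn commutes with.\<close>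

lemma vertex_deriv_psum_times:
  "vertex_deriv (zconst (psum (Suc k)) * F)
     = zconst (psum (Suc k)) * vertex_deriv F + (zpow (- int (Suc k)) + zpow (int (Suc k))) * F"
proof -
  let ?p = "psum (Suc k)"
  have m: "Poly_Mapping.map (sf_deriv (Suc i)) (zconst ?p * F)
      = zconst ?p * Poly_Mapping.map (sf_deriv (Suc i)) F + (if i = k then F else 0)" for i
    by (rule poly_mapping_eqI)
       (simp add: lookup_map_sf_deriv lookup_zconst_times lookup_add sf_deriv_psum_times)
  have "vterm (zconst ?p * F) i = zconst ?p * vterm F i
      + (if i = k then (zpow (- int (Suc k)) + zpow (int (Suc k))) * F else 0)" for i
    unfolding vterm_def m by (simp add: algebra_simps)
  moreover have "finite {i. zconst ?p * vterm F i \<noteq> 0}"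
    by (rule finite_subset[OF _ finite_vterm[of F]]) auto
  ultimately show ?thesis
    by (simp add: vertex_deriv_vterm Sum_any.distrib Sum_any_right_distrib finite_vterm)
qed

lemma vertex_deriv_sf_const [simp]: "vertex_deriv (zconst (sf_const c)) = 0"
  by (simp add: vertex_deriv_def)

lemma vertex_deriv_zpow_times: "vertex_deriv (zpow m * F) = zpow m * vertex_deriv F"
proof -
  have "Poly_Mapping.lookup (zpow m * G) n = Poly_Mapping.lookup G (n - m)" for G :: laurent_poly and n
    by (induction G rule: update_induct)
       (auto simp: update_eq_add_single distrib_left mult_single lookup_add lookup_single when_def)
  then have "vterm (zpow m * F) i = zpow m * vterm F i" for i
    unfolding vterm_def mult.assoc[symmetric]
    by (intro arg_cong2[where f = "(*)"] poly_mapping_eqI refl) (simp add: lookup_map_sf_deriv)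
  then show ?thesis
    by (simp add: vertex_deriv_vterm Sum_any_right_distrib finite_vterm)
qed

section \<open>The exponential of the derivations\<close>

text \<open>All powers from \<open>K\<close> on vanish. The bound \<open>n\<close> stays free so
  that several exponentials can be summed over one range.\<close>

lemma op_exp_finite:
  assumes "(T ^^ K) F = 0" "T 0 = 0" "K \<le> n"
  shows "op_exp T F = (\<Sum>k<n. zconst (sf_const (1 / fact k)) * (T ^^ k) F)"
proof -
  have *: "(T ^^ k) F = 0" if "K \<le> k" for k
  proof -
    have "(T ^^ (d + K)) F = 0" for d
      by (induction d) (simp_all add: assms)
    from this[of "k - K"] that show ?thesis by simp
  qed
  show ?thesis unfolding op_exp_def
    by (rule Sum_any.expand_superset) (use * \<open>K \<le> n\<close> in \<open>auto simp: not_less\<close>, (meson not_less order_trans)?)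
qed

text \<open>By induction \<open>T\<^sup>k P = P T\<^sup>k + k C T\<^sup>k\<^sup>-\<^sup>1\<close>.\<close>

lemma op_exp_psum_times:
  assumes add: "\<And>F G. T (F + G) = T F + T G" and comm: "\<And>F. T (P * F) = P * T F + C * F"
    and central: "\<And>F. T (C * F) = C * T F" and K: "(T ^^ K) F = 0"
  shows "(T ^^ Suc K) (P * F) = 0" and "op_exp T (P * F) = (P + C) * op_exp T F"
proof -
  have T0: "T 0 = 0" using add[of 0 0] by simp
  have of_nat_T: "T (of_nat n * G) = of_nat n * T G" for n G
    by (induction n) (simp_all add: T0 add distrib_right)
  have pow: "(T ^^ k) (P * F) = P * (T ^^ k) F + of_nat k * (C * (T ^^ (k - 1)) F)" for k
  proof (induction k)
    case (Suc k)
    \<comment> \<open>For \<open>k = 0\<close> the truncated \<open>k - 1\<close> is harmless, since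
      the factor \<open>of_nat k\<close> is 0.\<close>
    have "C * (T ((T ^^ (k - 1)) F)) * of_nat k = C * (T ^^ k) F * of_nat k"
      by (cases k) simp_all
    with Suc show ?case
      by (simp add: add comm central of_nat_T algebra_simps)
  qed simp
  show K': "(T ^^ Suc K) (P * F) = 0"
    by (simp only: pow) (simp add: K T0)
  let ?c = "\<lambda>k. zconst (sf_const (1 / fact k))"
  \<comment> \<open>This cancellation in the factorials turns the commutator terms, after an index
    shift, into \<open>C\<close> times the exponential.\<close>
  have c: "?c (Suc k) * of_nat (Suc k) = ?c k" for k
  proof -
    have "of_nat (Suc k) = zconst (sf_const (of_nat (Suc k)))"
      by (simp add: sf_const_def del: of_nat_Suc)
    then show ?thesis
      by (simp add: mult_single sf_const_def fact_Suc del: of_nat_Suc single_of_nat)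
  qed
  have "op_exp T (P * F) = (\<Sum>k<Suc (Suc K). ?c k * (T ^^ k) (P * F))"
    by (rule op_exp_finite[OF K' T0]) simp
  also have "\<dots> = P * (\<Sum>k<Suc (Suc K). ?c k * (T ^^ k) F)
      + (\<Sum>k<Suc (Suc K). C * (?c k * of_nat k * (T ^^ (k - 1)) F))"
    by (simp only: pow) (simp only: distrib_left sum.distrib sum_distrib_left mult_ac)
  also have "(\<Sum>k<Suc (Suc K). ?c k * (T ^^ k) F) = op_exp T F"
    by (rule op_exp_finite[OF K T0, symmetric]) simp
  also have "(\<Sum>k<Suc (Suc K). C * (?c k * of_nat k * (T ^^ (k - 1)) F))
      = (\<Sum>k<Suc K. C * (?c (Suc k) * of_nat (Suc k) * (T ^^ k) F))"
    by (subst sum.lessThan_Suc_shift) simp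
  also have "\<dots> = C * (\<Sum>k<Suc K. ?c k * (T ^^ k) F)"
    by (simp only: c sum_distrib_left)
  also have "(\<Sum>k<Suc K. ?c k * (T ^^ k) F) = op_exp T F"
    by (rule op_exp_finite[OF K T0, symmetric]) simp
  finally show "op_exp T (P * F) = (P + C) * op_exp T F" by (simp add: distrib_right)
qed

definition zpair :: "nat \<Rightarrow> laurent_poly" where
  "zpair k = zpow (int k) + zpow (- int k)"

text \<open>\<open>e = -1\<close> is the derivative factor of \<open>Y(z)\<close>, \<open>e = 1\<close> that of \<open>Y*(z)\<close>.\<close>

definition shift_hom :: "int \<Rightarrow> symfun \<Rightarrow> laurent_poly" where
  "shift_hom e f = op_exp (\<lambda>F. of_int e * vertex_deriv F) (zconst f)"

lemma vertex_deriv_of_int_times: "vertex_deriv (of_int e * F) = of_int e * vertex_deriv F"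
proof -
  have add: "vertex_deriv (F + G) = vertex_deriv F + vertex_deriv G" for F G by (rule vertex_deriv_add)
  have zero: "vertex_deriv 0 = 0" using add[of 0 0] by simp
  have minus: "vertex_deriv (- F) = - vertex_deriv F" for F
    using add[of F "- F"] zero by (simp add: eq_neg_iff_add_eq_0 add.commute)
  have nat: "vertex_deriv (of_nat n * F) = of_nat n * vertex_deriv F" for n
    by (induction n) (simp_all add: zero add distrib_right)
  show ?thesis
  proof (cases e)
    case (nonneg n)
    then show ?thesis by (simp add: nat)
  next
    case (neg n)
    then have "of_int e = - (of_nat (Suc n) :: laurent_poly)" by simp
    then show ?thesis by (simp add: minus nat del: of_nat_Suc)
  qed
qed

text \<open>The hypotheses of \<open>op_exp_psum_times\<close>, with \<open>P\<close> the power sum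
  and \<open>C\<close> the element \<open>of_int e * zpair (Suc k)\<close>.\<close>

lemma shift_T_lemmas:
  fixes e
  defines "T \<equiv> \<lambda>F. of_int e * vertex_deriv F"
  shows shift_T_add: "T (F + G) = T F + T G"
    and shift_T_psum: "T (zconst (psum (Suc k)) * F) = zconst (psum (Suc k)) * T F + (of_int e * zpair (Suc k)) * F"
    and shift_T_central: "T (of_int e * zpair (Suc k) * F) = of_int e * zpair (Suc k) * T F"
proof -
  have zp: "vertex_deriv (zpair (Suc k) * F) = zpair (Suc k) * vertex_deriv F"
    by (simp add: zpair_def distrib_right vertex_deriv_add vertex_deriv_zpow_times)
  show "T (F + G) = T F + T G"
    by (simp add: T_def vertex_deriv_add distrib_left)
  show "T (zconst (psum (Suc k)) * F) = zconst (psum (Suc k)) * T F + (of_int e * zpair (Suc k)) * F"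
    by (simp only: T_def vertex_deriv_psum_times zpair_def) (simp add: algebra_simps)
  show "T (of_int e * zpair (Suc k) * F) = of_int e * zpair (Suc k) * T F"
    by (simp add: T_def mult.assoc vertex_deriv_of_int_times zp)
qed

text \<open>A constant is killed at once, and each power sum factor raises the nilpotency order by
  at most one.\<close>

lemma shift_hom_nilpotent: "\<exists>K. ((\<lambda>F. of_int e * vertex_deriv F) ^^ K) (zconst f) = 0"
proof (induction f rule: symfun_induct)
  case (const c)
  show ?case by (rule exI[of _ 1]) simp
next
  case (add f g)
  let ?T = "\<lambda>F. of_int e * vertex_deriv F"
  obtain K L where KL: "(?T ^^ K) (zconst f) = 0" "(?T ^^ L) (zconst g) = 0" using add by blast
  have z: "(?T ^^ n) 0 = 0" for n using shift_T_add[of e 0 0] by (induction n) auto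
  have a: "(?T ^^ n) (F + G) = (?T ^^ n) F + (?T ^^ n) G" for n F G
    by (induction n) (simp_all add: vertex_deriv_add distrib_left)
  have "(?T ^^ (K + L)) (zconst f) = 0"
    using KL(1) by (subst add.commute) (simp only: funpow_add o_apply z)
  moreover have "(?T ^^ (K + L)) (zconst g) = 0"
    using KL(2) by (simp only: funpow_add o_apply z)
  ultimately show ?case by (intro exI[of _ "K + L"]) (simp only: single_add a add_0_left)
next
  case (mult k f)
  then obtain K where "((\<lambda>F. of_int e * vertex_deriv F) ^^ K) (zconst f) = 0" ..
  from op_exp_psum_times(1)[OF shift_T_add shift_T_psum shift_T_central this]
  show ?case by (metis mult_single add_0)
qed

lemma shift_hom_psum_times:
  "shift_hom e (psum (Suc k) * f) = (zconst (psum (Suc k)) + of_int e * zpair (Suc k)) * shift_hom e f"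
proof -
  obtain K where "((\<lambda>F. of_int e * vertex_deriv F) ^^ K) (zconst f) = 0"
    using shift_hom_nilpotent by blast
  from op_exp_psum_times(2)[OF shift_T_add shift_T_psum shift_T_central this]
  show ?thesis by (simp add: shift_hom_def mult_single)
qed

lemma shift_hom_sf_const: "shift_hom e (sf_const c) = zconst (sf_const c)"
proof -
  have "op_exp (\<lambda>F. of_int e * vertex_deriv F) (zconst (sf_const c))
     = (\<Sum>k<1. zconst (sf_const (1 / fact k)) * ((\<lambda>F. of_int e * vertex_deriv F) ^^ k) (zconst (sf_const c)))"
    by (rule op_exp_finite[where K = 1]) (use vertex_deriv_sf_const[of 0] in \<open>simp_all add: sf_const_def[of 0]\<close>)
  then show ?thesis by (simp add: shift_hom_def sf_const_def)
qed

lemma shift_hom_add: "shift_hom e (f + g) = shift_hom e f + shift_hom e g"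
proof -
  let ?T = "\<lambda>F. of_int e * vertex_deriv F"
  obtain K where K: "(?T ^^ K) (zconst f) = 0" using shift_hom_nilpotent by blast
  obtain L where L: "(?T ^^ L) (zconst g) = 0" using shift_hom_nilpotent by blast
  obtain M where M: "(?T ^^ M) (zconst (f + g)) = 0" using shift_hom_nilpotent by blast
  have T0: "?T 0 = 0" using shift_T_add[of e 0 0] by auto
  have a: "(?T ^^ n) (F + G) = (?T ^^ n) F + (?T ^^ n) G" for n F G
    by (induction n) (simp_all add: vertex_deriv_add distrib_left)
  show ?thesis
    unfolding shift_hom_def
    \<comment> \<open>The bound \<open>K + L + M\<close> serves all three exponentials, which can
      then be compared term by term.\<close>
    by (subst op_exp_finite[OF K T0, of "K + L + M"] op_exp_finite[OF L T0, of "K + L + M"]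
        op_exp_finite[OF M T0, of "K + L + M"], simp)+
       (simp only: single_add a distrib_left sum.distrib)
qed

text \<open>The exponential of a derivation is multiplicative: by
  \<open>shift_hom_psum_times\<close> each generator can be pulled out of the first factor. A
  constant first factor takes a second induction, on \<open>g\<close>.\<close>

lemma shift_hom_mult: "shift_hom e (f * g) = shift_hom e f * shift_hom e g"
proof (induction f rule: symfun_induct)
  case (const c)
  show ?case
  proof (induction g rule: symfun_induct)
    case (const d)
    have "sf_const c * sf_const d = sf_const (c * d)" by (simp add: sf_const_def mult_single)
    then show ?case by (simp add: shift_hom_sf_const) (simp add: sf_const_def mult_single)
  next
    case (add f g)
    then show ?case by (simp add: shift_hom_add distrib_left)
  next
    case (mult k f)
    have "sf_const c * (psum (Suc k) * f) = psum (Suc k) * (sf_const c * f)" by (simp add: mult_ac)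
    then show ?case by (simp only: shift_hom_psum_times mult.IH) (simp only: mult_ac)
  qed
next
  case (add f f')
  then show ?case by (simp add: shift_hom_add distrib_right)
next
  case (mult k f)
  then show ?case by (simp add: shift_hom_psum_times mult.assoc)
qed

lemma shift_hom_0 [simp]: "shift_hom e 0 = 0"
  using shift_hom_sf_const[of e 0] by (simp add: sf_const_def)

lemma shift_hom_1 [simp]: "shift_hom e 1 = 1"
  using shift_hom_sf_const[of e 1] by (simp add: sf_const_def)

interpretation shift_hom: comm_ring_hom "shift_hom e" for e
  by unfold_locales (simp_all add: shift_hom_add shift_hom_mult)

lemma shift_hom_psum: "shift_hom e (psum (Suc k)) = zconst (psum (Suc k)) + of_int e * zpair (Suc k)"
  using shift_hom_psum_times[of e k 1] by simp

section \<open>Generating series\<close>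

text \<open>In characteristic 0 the equation determines each coefficient from the earlier ones.
  Identities between exponentials below are proved by comparing logarithmic derivatives in this
  way.\<close>

lemma fps_linear_ode_unique:
  fixes F G Q :: "'a::{idom, ring_char_0} fps"
  assumes "fps_deriv F = Q * F" "fps_deriv G = Q * G" "fps_nth F 0 = fps_nth G 0"
  shows "F = G"
proof (rule fps_ext)
  fix n
  show "fps_nth F n = fps_nth G n"
  proof (induction n rule: less_induct)
    case (less n)
    show ?case
    proof (cases n)
      case (Suc m)
      have "fps_nth (Q * F) m = fps_nth (Q * G) m"
        unfolding fps_mult_nth by (rule sum.cong[OF refl]) (use Suc less in auto)
      then have "of_nat (Suc m) * fps_nth F (Suc m) = of_nat (Suc m) * fps_nth G (Suc m)"
        using assms by (metis fps_deriv_nth Suc_eq_plus1)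
      then show ?thesis unfolding Suc by (simp del: of_nat_Suc)
    qed (use assms in simp)
  qed
qed

text \<open>Here \<open>e = 1\<close> gives the generating series of the complete functions and
  \<open>e = -1\<close> its inverse. Keeping the sign as a parameter treats both vertex operators at
  once.\<close>

definition exp_series :: "int \<Rightarrow> symfun fps" where
  "exp_series e = sf_fps_exp (of_int e * psum_series)"

lemma of_nat_times_sf_const_inverse:
  "n > 0 \<Longrightarrow> of_nat n * sf_const (1 / of_nat n) = 1"
proof -
  assume "n > 0"
  have "of_nat n = sf_const (of_nat n)" by (simp add: sf_const_def)
  then show ?thesis using \<open>n > 0\<close> by (simp add: sf_const_def mult_single del: single_of_nat)
qed

lemma fps_deriv_sf_fps_exp:
  assumes "fps_nth F 0 = 0"
  shows "fps_deriv (sf_fps_exp F) = fps_deriv F * sf_fps_exp F"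
proof -
  have "of_nat (Suc n) * sf_const (1 / fact (Suc n)) = sf_const (1 / fact n)" for n
  proof -
    have "sf_const (1 / fact (Suc n)) = sf_const (1 / of_nat (Suc n)) * sf_const (1 / fact n)"
      by (simp add: sf_const_def mult_single fact_Suc del: of_nat_Suc)
    then show ?thesis
      by (simp only: mult.assoc[symmetric] of_nat_times_sf_const_inverse zero_less_Suc mult_1)
  qed
  then have "fps_deriv (Abs_fps (\<lambda>n. sf_const (1 / fact n))) = Abs_fps (\<lambda>n. sf_const (1 / fact n))"
    by (intro fps_ext) (simp del: of_nat_Suc fact_Suc)
  then show ?thesis
    by (simp add: sf_fps_exp_def fps_compose_deriv[OF assms] mult.commute)
qed

lemma sf_fps_exp_nth_0: "fps_nth (sf_fps_exp F) 0 = 1"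
  by (simp add: sf_fps_exp_def sf_const_def)

definition psum_gen :: "symfun fps" where
  "psum_gen = Abs_fps (\<lambda>n. psum (Suc n))"

lemma fps_deriv_psum_series: "fps_deriv psum_series = psum_gen"
  by (rule fps_ext)
     (simp add: psum_series_def psum_gen_def mult.assoc[symmetric] of_nat_times_sf_const_inverse del: of_nat_Suc)

lemma fps_nth_of_int_times: "fps_nth (of_int e * F) n = of_int e * fps_nth F n"
  by (simp add: fps_of_int[symmetric])

lemma fps_deriv_of_int_times: "fps_deriv (of_int e * F) = of_int e * fps_deriv F"
  by (simp add: fps_of_int[symmetric])

lemma fps_deriv_exp_series: "fps_deriv (exp_series e) = of_int e * psum_gen * exp_series e"
proof -
  have "fps_nth psum_series 0 = 0" by (simp add: psum_series_def)
  then show ?thesis unfolding exp_series_def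
    by (simp add: fps_deriv_sf_fps_exp fps_nth_of_int_times fps_deriv_of_int_times fps_deriv_psum_series)
qed

lemma exp_series_nth_0 [simp]: "fps_nth (exp_series e) 0 = 1"
  by (simp add: exp_series_def sf_fps_exp_nth_0)

text \<open>The two logarithmic derivatives cancel, so the product is constant.\<close>

lemma exp_series_inverse: "exp_series 1 * exp_series (- 1) = 1"
  by (rule fps_linear_ode_unique[where Q = 0]) (simp_all add: fps_deriv_exp_series)

text \<open>\<open>hcoeff 1 n\<close> is \<open>h\<^sub>n\<close> and \<open>hcoeff (- 1) n\<close> is \<open>(-1)\<^sup>n e\<^sub>n\<close>.\<close>

definition hcoeff :: "int \<Rightarrow> int \<Rightarrow> symfun" where
  "hcoeff e n = (if n < 0 then 0 else fps_nth (exp_series e) (nat n))"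

lemma hcoeff_neg [simp]: "n < 0 \<Longrightarrow> hcoeff e n = 0"
  by (simp add: hcoeff_def)

lemma hcoeff_0 [simp]: "hcoeff e 0 = 1"
  by (simp add: hcoeff_def)

lemma hsym_eq_hcoeff: "hsym n = hcoeff 1 n"
  by (simp add: hsym_def hcoeff_def exp_series_def)

text \<open>The series of the \<open>esym n\<close> arises from \<open>exp_series (- 1)\<close> by
  replacing z with -z. Both solve the linear equation with coefficient \<open>Q\<close>.\<close>

lemma esym_eq_hcoeff: "esym n = (-1) ^ nat n * hcoeff (- 1) n"
proof (cases "n < 0")
  case False
  define F :: "symfun fps" where "F = - Abs_fps (\<lambda>m. if m = 0 then 0 else sf_const ((-1) ^ m / of_nat m) * psum m)"
  define s :: "nat \<Rightarrow> symfun" where "s = (\<lambda>m. (- 1) ^ m)"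
  define G where "G = Abs_fps (\<lambda>m. s m * fps_nth (exp_series (- 1)) m)"
  define Q where "Q = Abs_fps (\<lambda>m. s m * psum (Suc m))"
  have "sf_const ((-1) ^ m) = s m" for m
    by (cases "even m") (simp_all add: s_def sf_const_def single_uminus)
  moreover have "sf_const ((-1) ^ m / of_nat m) = sf_const ((-1) ^ m) * sf_const (1 / of_nat m)" for m
    by (simp add: sf_const_def mult_single)
  ultimately have s: "sf_const ((-1) ^ m / of_nat m) = s m * sf_const (1 / of_nat m)" for m
    by simp
  have "fps_deriv F = Q"
  proof (rule fps_ext)
    fix n
    have "fps_nth F (Suc n) = - (s (Suc n) * sf_const (1 / of_nat (Suc n)) * psum (Suc n))"
      unfolding F_def s by simp
    then have "fps_nth (fps_deriv F) n
        = s n * (of_nat (Suc n) * sf_const (1 / of_nat (Suc n))) * psum (Suc n)"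
      by (simp add: s_def mult_ac del: of_nat_Suc)
    then show "fps_nth (fps_deriv F) n = fps_nth Q n"
      by (simp add: of_nat_times_sf_const_inverse Q_def del: of_nat_Suc)
  qed
  then have "fps_deriv (sf_fps_exp F) = Q * sf_fps_exp F"
    by (simp add: fps_deriv_sf_fps_exp F_def)
  moreover have "fps_deriv G = Q * G"
  proof (rule fps_ext)
    fix n
    have "fps_nth (fps_deriv G) n = s (Suc n) * fps_nth (fps_deriv (exp_series (- 1))) n"
      by (simp add: G_def)
    also have "\<dots> = s n * fps_nth (psum_gen * exp_series (- 1)) n"
      by (simp add: fps_deriv_exp_series s_def)
    also have "\<dots> = fps_nth (Q * G) n"
      unfolding fps_mult_nth sum_distrib_left
    proof (rule sum.cong[OF refl])
      fix i assume "i \<in> {0..n}"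
      then have "s n = s i * s (n - i)" by (simp add: s_def flip: power_add)
      then show "s n * (fps_nth psum_gen i * fps_nth (exp_series (- 1)) (n - i)) = fps_nth Q i * fps_nth G (n - i)"
        by (simp add: Q_def G_def psum_gen_def mult_ac)
    qed
    finally show "fps_nth (fps_deriv G) n = fps_nth (Q * G) n" .
  qed
  ultimately have "sf_fps_exp F = G"
    by (rule fps_linear_ode_unique) (simp add: G_def sf_fps_exp_nth_0 s_def)
  then show ?thesis using False
    by (simp add: esym_def hcoeff_def G_def s_def F_def)
qed (simp add: esym_def)

text \<open>\<open>cheb n = z\<^sup>n + z\<^sup>n\<^sup>-\<^sup>2 + \<dots> + z\<^sup>-\<^sup>n\<close>, the coefficients of \<open>1 / ((1 - zw) (1 - w/z))\<close> in \<open>w\<close>.\<close>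

fun cheb :: "nat \<Rightarrow> laurent_poly" where
  "cheb 0 = 1"
| "cheb (Suc 0) = zpair 1"
| "cheb (Suc (Suc n)) = zpair 1 * cheb (Suc n) - cheb n"

lemma zpair_1_times_zpow: "zpair 1 * zpow m = zpow (m + 1) + zpow (m - 1)"
  by (simp add: zpair_def distrib_right mult_single add.commute)

lemma zpair_Suc_Suc: "zpair 1 * zpair (Suc n) = zpair (Suc (Suc n)) + zpair n"
proof -
  have "int (Suc n) + 1 = int (Suc (Suc n))" "int (Suc n) - 1 = int n"
    "- int (Suc n) + 1 = - int n" "- int (Suc n) - 1 = - int (Suc (Suc n))" by simp_all
  note e = this
  have "zpair 1 * zpair (Suc n) = zpair 1 * zpow (int (Suc n)) + zpair 1 * zpow (- int (Suc n))"
    by (simp add: zpair_def[of "Suc n"] distrib_left)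
  also have "\<dots> = zpair (Suc (Suc n)) + zpair n"
    unfolding zpair_1_times_zpow e by (simp only: zpair_def add_ac)
  finally show ?thesis .
qed

text \<open>Two sums of equal parity differ by their outermost powers. Both sides follow the same
  recursion, but \<open>zpair 0\<close> is 2 whereas \<open>cheb 0\<close> is 1, hence the separate
  start.\<close>

lemma cheb_diff: "cheb (Suc (Suc n)) - cheb n = zpair (Suc (Suc n))"
proof (induction n rule: less_induct)
  case (less n)
  consider "n = 0" | "n = 1" | m where "n = Suc (Suc m)"
    by (metis One_nat_def not0_implies_Suc)
  then show ?case
  proof cases
    case 1
    then show ?thesis using zpair_Suc_Suc[of 0] by (simp add: zpair_def algebra_simps numeral_2_eq_2)
  next
    case 2
    then show ?thesis using less[of 0] zpair_Suc_Suc[of 1] by (simp add: algebra_simps)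
  next
    case 3
    then show ?thesis using less[of m] less[of "Suc m"] zpair_Suc_Suc[of "Suc (Suc m)"]
      by (simp add: algebra_simps)
  qed
qed

text \<open>A geometric sum. It explains the factor 1 - z^2 in the series of \<open>Ystar\<close>:
  it leaves two powers, which become the two terms of an entry of \<open>e_det\<close>.\<close>

lemma cheb_closed: "(1 - zpow 2) * cheb n = zpow (- int n) - zpow (int n + 2)"
proof (induction n rule: cheb.induct)
  case 1
  show ?case by (simp add: single_one[symmetric] del: single_one)
next
  case 2
  have "zpow 2 * zpair 1 = zpair 1 * zpow 2" by (rule mult.commute)
  then show ?case
    by (simp only: cheb.simps left_diff_distrib mult_1 zpair_1_times_zpow) (simp add: zpair_def)
next
  case (3 n)
  have e: "- int (Suc n) + 1 = - int n" "- int (Suc n) - 1 = - int (Suc (Suc n))"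
    "int (Suc n) + 2 + 1 = int (Suc (Suc n)) + 2" "int (Suc n) + 2 - 1 = int n + 2" by simp_all
  have "(1 - zpow 2) * cheb (Suc (Suc n))
      = zpair 1 * ((1 - zpow 2) * cheb (Suc n)) - (1 - zpow 2) * cheb n"
    by (simp add: algebra_simps)
  also have "\<dots> = zpow (- int (Suc (Suc n))) - zpow (int (Suc (Suc n)) + 2)"
    unfolding 3 right_diff_distrib zpair_1_times_zpow e by (simp only: algebra_simps)
  finally show ?case .
qed

section \<open>Generating series in w with coefficients that are Laurent polynomials in z\<close>

definition fps_zconst :: "symfun fps \<Rightarrow> laurent_poly fps" where
  "fps_zconst F = Abs_fps (\<lambda>n. zconst (fps_nth F n))"

definition fps_shift_hom :: "int \<Rightarrow> symfun fps \<Rightarrow> laurent_poly fps" where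
  "fps_shift_hom e F = Abs_fps (\<lambda>n. shift_hom e (fps_nth F n))"

text \<open>\<open>(1 - zw) (1 - w/z)\<close>, as a power series in \<open>w\<close>.\<close>

definition quad :: "laurent_poly fps" where
  "quad = 1 - fps_const (zpair 1) * fps_X + fps_X ^ 2"

lemma fps_nth_times_quad:
  "fps_nth (F * quad) n = fps_nth F n - (if n < 1 then 0 else zpair 1 * fps_nth F (n - 1)) +
     (if n < 2 then 0 else fps_nth F (n - 2))"
proof -
  have "F * quad = F - fps_X * (fps_const (zpair 1) * F) + fps_X ^ 2 * F"
    by (simp add: quad_def algebra_simps)
  then show ?thesis by (simp add: fps_X_power_mult_nth)
qed

lemma fps_nth_quad:
  "fps_nth quad n = (if n = 0 \<or> n = 2 then 1 else if n = 1 then - zpair 1 else 0)"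
  using fps_nth_times_quad[of 1 n] by (auto simp: less_2_cases_iff)

lemma cheb_times_quad: "Abs_fps cheb * quad = 1"
proof (rule fps_ext)
  fix n
  consider "n = 0" | "n = 1" | m where "n = Suc (Suc m)"
    by (metis One_nat_def not0_implies_Suc)
  then show "fps_nth (Abs_fps cheb * quad) n = fps_nth 1 n"
    unfolding fps_nth_times_quad by cases simp_all
qed

lemma fps_zconst_mult: "fps_zconst (F * G) = fps_zconst F * fps_zconst G"
proof -
  have "zconst (sum f A) = (\<Sum>x\<in>A. zconst (f x))" for f :: "'c \<Rightarrow> symfun" and A
    by (induction A rule: infinite_finite_induct) (simp_all add: single_add)
  then show ?thesis
    by (intro fps_ext) (simp add: fps_zconst_def fps_mult_nth mult_single)
qed

lemma fps_shift_hom_mult: "fps_shift_hom e (F * G) = fps_shift_hom e F * fps_shift_hom e G"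
  by (intro fps_ext) (simp add: fps_shift_hom_def fps_mult_nth shift_hom.hom_sum shift_hom_mult)

lemma fps_deriv_fps_zconst: "fps_deriv (fps_zconst F) = fps_zconst (fps_deriv F)"
  by (intro fps_ext) (simp add: fps_zconst_def mult_single single_of_nat[symmetric] del: single_of_nat of_nat_Suc)

lemma fps_deriv_fps_shift_hom: "fps_deriv (fps_shift_hom e F) = fps_shift_hom e (fps_deriv F)"
  by (intro fps_ext) (simp add: fps_shift_hom_def shift_hom_mult shift_hom.hom_of_nat del: of_nat_Suc)

text \<open>The shift adds e d times the sum of (z^n + z^-n) w^n / n to the exponent. For
  \<open>e * d = - 1\<close> this is the logarithm of (1 - zw)(1 - w/z).\<close>

lemma fps_shift_hom_exp_series:
  assumes "e * d = - 1"
  shows "fps_shift_hom d (exp_series e) = fps_zconst (exp_series e) * quad"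
proof (rule fps_linear_ode_unique)
  define Zs where "Zs = Abs_fps (\<lambda>n. zpair (Suc n))"
  have ed: "of_int e * of_int d = (-1 :: laurent_poly fps)"
    using assms by (metis of_int_mult of_int_minus of_int_1)
  \<comment> \<open>The logarithmic derivative of \<open>quad\<close>. In degree 1 the value
    \<open>zpair 0 = 2\<close> enters.\<close>
  have Zs: "Zs * quad = - fps_deriv quad"
  proof (rule fps_ext)
    fix n
    consider "n = 0" | "n = 1" | m where "n = Suc (Suc m)"
      by (metis One_nat_def not0_implies_Suc)
    then show "fps_nth (Zs * quad) n = fps_nth (- fps_deriv quad) n"
    proof cases
      case 1
      then show ?thesis
        unfolding fps_nth_times_quad by (simp add: fps_nth_quad Zs_def)
    next
      case 2
      have "zpair 1 * zpair 1 = zpair 2 + 2"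
        using zpair_Suc_Suc[of 0] by (simp add: zpair_def[of 0] numeral_2_eq_2)
      with 2 show ?thesis
        unfolding fps_nth_times_quad by (simp add: fps_nth_quad Zs_def numeral_2_eq_2)
    next
      case (3 m)
      with zpair_Suc_Suc[of "Suc m"] show ?thesis
        unfolding fps_nth_times_quad by (simp add: fps_nth_quad Zs_def)
    qed
  qed
  have shP: "fps_shift_hom d psum_gen = fps_zconst psum_gen + of_int d * Zs"
    by (rule fps_ext)
       (simp add: fps_shift_hom_def fps_zconst_def psum_gen_def shift_hom_psum Zs_def fps_nth_of_int_times fps_of_int[symmetric])
  let ?Q = "of_int e * fps_shift_hom d psum_gen"
  have c: "fps_zconst (of_int e) = of_int e" "fps_shift_hom d (of_int e) = of_int e"
    by (rule fps_ext; simp add: fps_zconst_def fps_shift_hom_def fps_of_int[symmetric] shift_hom.hom_of_int)+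
  show "fps_deriv (fps_shift_hom d (exp_series e)) = ?Q * fps_shift_hom d (exp_series e)"
    by (simp add: fps_deriv_fps_shift_hom fps_deriv_exp_series fps_shift_hom_mult c)
  have "fps_deriv (fps_zconst (exp_series e) * quad)
      = of_int e * fps_zconst psum_gen * fps_zconst (exp_series e) * quad
         + fps_zconst (exp_series e) * fps_deriv quad"
    by (simp add: fps_deriv_fps_zconst fps_deriv_exp_series fps_zconst_mult c)
  also have "fps_deriv quad = of_int e * of_int d * (Zs * quad)"
    by (simp only: ed Zs) simp
  finally show "fps_deriv (fps_zconst (exp_series e) * quad) = ?Q * (fps_zconst (exp_series e) * quad)"
    by (simp add: shP algebra_simps)
  show "fps_nth (fps_shift_hom d (exp_series e)) 0 = fps_nth (fps_zconst (exp_series e) * quad) 0"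
    by (simp add: fps_shift_hom_def fps_zconst_def quad_def)
qed

lemma exp_series_inverse':
  assumes "\<bar>e\<bar> = 1"
  shows "exp_series e * exp_series (- e) = 1"
  using exp_series_inverse assms by (cases "e = 1") (auto simp: mult.commute abs_if split: if_splits)

text \<open>The inverse series is multiplied by \<open>quad\<close> under the same homomorphism, so
  this one is multiplied by 1 / \<open>quad\<close>, which is the series of the
  \<open>cheb n\<close>.\<close>

lemma fps_shift_hom_exp_series':
  assumes "\<bar>e\<bar> = 1"
  shows "fps_shift_hom e (exp_series e) = fps_zconst (exp_series e) * Abs_fps cheb"
proof -
  let ?K = "fps_zconst (exp_series e)" and ?L = "fps_zconst (exp_series (- e))"
  have one: "fps_shift_hom e 1 = 1" "fps_zconst 1 = 1"
    by (rule fps_ext; simp add: fps_shift_hom_def fps_zconst_def)+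
  have "- e * e = - 1" using assms by (auto simp: abs_if split: if_splits)
  then have "fps_shift_hom e (exp_series e) * (?L * quad) = fps_shift_hom e (exp_series e * exp_series (- e))"
    by (simp add: fps_shift_hom_mult fps_shift_hom_exp_series)
  also have "\<dots> = 1" by (simp add: exp_series_inverse'[OF assms] one)
  finally have *: "fps_shift_hom e (exp_series e) * (?L * quad) = 1" .
  have "?K * ?L = 1" by (simp add: fps_zconst_mult[symmetric] exp_series_inverse'[OF assms] one)
  have "?L * quad * (?K * Abs_fps cheb) = (?K * ?L) * (Abs_fps cheb * quad)"
    by (simp only: mult_ac)
  also have "\<dots> = 1" by (simp only: \<open>?K * ?L = 1\<close> cheb_times_quad mult_1)
  finally have "fps_shift_hom e (exp_series e)
      = fps_shift_hom e (exp_series e) * (?L * quad) * (?K * Abs_fps cheb)"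
    by (simp only: mult.assoc mult_1_right)
  then show ?thesis by (simp only: * mult_1)
qed

lemma shift_hom_hcoeff:
  assumes "e * d = - 1"
  shows "shift_hom d (hcoeff e n) = zconst (hcoeff e n) - zpair 1 * zconst (hcoeff e (n - 1)) + zconst (hcoeff e (n - 2))"
proof (cases "n < 0")
  case False
  then show ?thesis
    using arg_cong[OF fps_shift_hom_exp_series[OF assms], of "\<lambda>F. fps_nth F (nat n)"]
    by (auto simp: fps_nth_times_quad fps_shift_hom_def fps_zconst_def hcoeff_def nat_diff_distrib)
qed simp

text \<open>Terms beyond \<open>n\<close> vanish, so any bound \<open>N\<close> is allowed; this
  freedom is used to align sums later.\<close>

lemma shift_hom_hcoeff':
  assumes "\<bar>e\<bar> = 1" "n \<le> int N"
  shows "shift_hom e (hcoeff e n) = (\<Sum>l\<le>N. zconst (hcoeff e (n - int l)) * cheb l)"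
proof (cases "n < 0")
  case False
  have "shift_hom e (hcoeff e n) = fps_nth (fps_zconst (exp_series e) * Abs_fps cheb) (nat n)"
    using False by (simp add: fps_shift_hom_exp_series'[OF assms(1), symmetric] fps_shift_hom_def hcoeff_def)
  also have "\<dots> = (\<Sum>l\<le>nat n. zconst (hcoeff e (n - int l)) * cheb l)"
    unfolding mult.commute[of "fps_zconst _"] fps_mult_nth atLeast0AtMost
    by (rule sum.cong[OF refl]) (use False in \<open>auto simp: fps_zconst_def hcoeff_def nat_diff_distrib mult.commute\<close>)
  also have "\<dots> = (\<Sum>l\<le>N. zconst (hcoeff e (n - int l)) * cheb l)"
    by (rule sum.mono_neutral_left) (use assms False in auto)
  finally show ?thesis .
qed simp

section \<open>Commutation relations\<close>

text \<open>The coefficient of \<open>z\<^sup>n\<close> in \<open>exp (e \<Sum> p\<^sub>k z\<^sup>k / k) F\<close>.\<close>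

definition zcoeff :: "int \<Rightarrow> int \<Rightarrow> laurent_poly \<Rightarrow> symfun" where
  "zcoeff e n F = (\<Sum>i\<in>Poly_Mapping.keys F. hcoeff e (n - i) * Poly_Mapping.lookup F i)"

lemma zcoeff_superset:
  assumes "finite A" "Poly_Mapping.keys F \<subseteq> A"
  shows "zcoeff e n F = (\<Sum>i\<in>A. hcoeff e (n - i) * Poly_Mapping.lookup F i)"
  unfolding zcoeff_def by (rule sum.mono_neutral_left) (use assms in \<open>auto simp: in_keys_iff\<close>)

lemma zcoeff_add: "zcoeff e n (F + G) = zcoeff e n F + zcoeff e n G"
proof -
  let ?A = "Poly_Mapping.keys F \<union> Poly_Mapping.keys G"
  have "zcoeff e n H = (\<Sum>i\<in>?A. hcoeff e (n - i) * Poly_Mapping.lookup H i)" if "H \<in> {F, G, F + G}" for H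
    by (rule zcoeff_superset) (use that keys_add[of F G] in auto)
  then show ?thesis by (simp add: lookup_add distrib_left sum.distrib)
qed

lemma zcoeff_uminus: "zcoeff e n (- F) = - zcoeff e n F"
proof -
  have "Poly_Mapping.keys (- F) = Poly_Mapping.keys F" by (auto simp: in_keys_iff)
  then show ?thesis by (simp add: zcoeff_def sum_negf)
qed

lemma zcoeff_diff: "zcoeff e n (F - G) = zcoeff e n F - zcoeff e n G"
  using zcoeff_add[of e n F "- G"] by (simp add: zcoeff_uminus)

lemma zcoeff_0 [simp]: "zcoeff e n 0 = 0"
  by (simp add: zcoeff_def)

lemma zcoeff_sum: "zcoeff e n (sum f A) = (\<Sum>x\<in>A. zcoeff e n (f x))"
  by (induction A rule: infinite_finite_induct) (simp_all add: zcoeff_add)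

lemma zcoeff_single: "zcoeff e n (Poly_Mapping.single i f) = hcoeff e (n - i) * f"
  by (cases "f = 0") (simp_all add: zcoeff_def)

lemma zcoeff_1 [simp]: "zcoeff e n 1 = hcoeff e n"
  using zcoeff_single[of e n 0 1] by simp

lemma zcoeff_zconst_times: "zcoeff e n (zconst f * F) = f * zcoeff e n F"
proof -
  have "Poly_Mapping.keys (zconst f * F) \<subseteq> Poly_Mapping.keys F"
    by (auto simp: in_keys_iff lookup_zconst_times)
  then show ?thesis
    by (subst zcoeff_superset[of "Poly_Mapping.keys F"])
       (simp_all add: lookup_zconst_times zcoeff_def sum_distrib_left mult.left_commute)
qed

lemma zcoeff_zpow_times: "zcoeff e n (zpow k * F) = zcoeff e (n - k) F"
  by (induction F rule: update_induct)
     (simp_all add: update_eq_add_single distrib_left zcoeff_add mult_single zcoeff_single algebra_simps)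

lemma zcoeff_zpair_times: "zcoeff e n (zpair k * F) = zcoeff e (n - int k) F + zcoeff e (n + int k) F"
  by (simp add: zpair_def distrib_right zcoeff_add zcoeff_zpow_times)

lemma zcoeff_zpair: "zcoeff e n (zpair k) = hcoeff e (n - int k) + hcoeff e (n + int k)"
  using zcoeff_zpair_times[of e n k 1] by simp

lemma fls_nth_exp_series_times:
  "fls_nth (fps_to_fls (exp_series e) * laurent_poly_to_fls F) n = zcoeff e n F"
proof -
  have "fls_nth (sum f A) m = (\<Sum>x\<in>A. fls_nth (f x) m)" for f :: "int \<Rightarrow> symfun fls" and A m
    by (induction A rule: infinite_finite_induct) simp_all
  moreover have "fls_nth (fps_to_fls (exp_series e) * (fls_const c * fls_X_intpow i)) n = hcoeff e (n - i) * c" for c i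
  proof -
    have "fps_to_fls (exp_series e) * (fls_const c * fls_X_intpow i)
        = fls_const c * (fps_to_fls (exp_series e) * fls_X_intpow i)" by (simp add: mult_ac)
    then show ?thesis by (simp only: fls_X_intpow_times_conv_shift(2)) (simp add: hcoeff_def mult.commute)
  qed
  ultimately show ?thesis
    by (simp only: laurent_poly_to_fls_def sum_distrib_left zcoeff_def)
qed

text \<open>\<open>Y\<close> and \<open>Ystar\<close> in one family, the latter without its factor 1
  - z^2 and both indexed by the exponent of z.\<close>

definition vop :: "int \<Rightarrow> int \<Rightarrow> symfun \<Rightarrow> symfun" where
  "vop e n f = zcoeff e n (shift_hom (- e) f)"

lemma Y_eq_vop: "Y n f = vop 1 (- n) f"
proof -
  have "Y_gen f = fps_to_fls (exp_series 1) * laurent_poly_to_fls (shift_hom (- 1) f)"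
    by (simp add: Y_gen_def exp_series_def shift_hom_def)
  then show ?thesis by (simp add: Y_def fls_nth_exp_series_times vop_def)
qed

lemma Ystar_eq_vop: "Ystar n f = vop (- 1) n f - vop (- 1) (n - 2) f"
proof -
  let ?F = "fps_to_fls (exp_series (- 1)) * laurent_poly_to_fls (shift_hom 1 f)"
  have "Ystar_gen f = ?F - fls_X ^ 2 * ?F"
    by (simp add: Ystar_gen_def exp_series_def shift_hom_def algebra_simps)
  then have "Ystar n f = fls_nth ?F n - fls_nth ?F (n - 2)"
    by (simp add: Ystar_def fls_X_power_times_conv_shift(1))
  then show ?thesis by (simp only: fls_nth_exp_series_times vop_def) simp
qed

lemma vop_add: "vop e n (f + g) = vop e n f + vop e n g"
  by (simp add: vop_def shift_hom_add zcoeff_add)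

lemma vop_uminus: "vop e n (- f) = - vop e n f"
  by (simp add: vop_def shift_hom.hom_uminus zcoeff_uminus)

lemma vop_diff: "vop e n (f - g) = vop e n f - vop e n g"
  by (simp add: vop_def shift_hom.hom_minus zcoeff_diff)

lemma vop_sf_const_times: "vop e n (sf_const c * f) = sf_const c * vop e n f"
  by (simp add: vop_def shift_hom_mult shift_hom_sf_const zcoeff_zconst_times)

lemma vop_psum_times:
  "vop e n (psum (Suc k) * f) = psum (Suc k) * vop e n f
     - of_int e * (vop e (n - int (Suc k)) f + vop e (n + int (Suc k)) f)"
proof -
  have "zcoeff e n (of_int e * F) = of_int e * zcoeff e n F" for F
    using zcoeff_zconst_times[of e n "of_int e" F] by simp
  then show ?thesis
    by (simp add: vop_def shift_hom_psum_times distrib_right zcoeff_add zcoeff_diff left_diff_distrib mult.assoc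
        zcoeff_zconst_times zcoeff_zpair_times del: of_nat_Suc)
qed

lemma vop_1: "vop e n 1 = hcoeff e n"
  by (simp add: vop_def)

lemma vop_sf_const: "vop e n (sf_const c) = sf_const c * hcoeff e n"
  using vop_sf_const_times[of e n c 1] by (simp add: vop_1)

lemma vop_hcoeff:
  assumes "\<bar>e\<bar> = 1"
  shows "vop e n (hcoeff e m) = hcoeff e m * hcoeff e n
     - hcoeff e (m - 1) * (hcoeff e (n - 1) + hcoeff e (n + 1)) + hcoeff e (m - 2) * hcoeff e n"
proof -
  have "e * - e = - 1" using assms by (auto simp: abs_if split: if_splits)
  then have "vop e n (hcoeff e m) = zcoeff e n (zconst (hcoeff e m) - zconst (hcoeff e (m - 1)) * zpair 1 + zconst (hcoeff e (m - 2)))"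
    unfolding vop_def by (simp add: shift_hom_hcoeff mult.commute)
  then show ?thesis
    by (simp only: zcoeff_add zcoeff_diff zcoeff_zconst_times zcoeff_zpair zcoeff_single) (simp add: mult.commute)
qed

text \<open>On constants the explicit formula \<open>vop_hcoeff\<close> makes the sum cancel. Moving
  a power sum outwards only shifts one of the two indices, so the induction runs over all
  \<open>n\<close> and \<open>m\<close> together.\<close>

lemma vop_exchange:
  assumes "\<bar>e\<bar> = 1"
  shows "vop e (n - 1) (vop e m f) + vop e (m - 1) (vop e n f) = 0"
proof -
  define S where "S n m f = vop e (n - 1) (vop e m f) + vop e (m - 1) (vop e n f)" for n m f
  have "S n m f = 0"
  proof (induction f arbitrary: n m rule: symfun_induct)
    case (const c)
    show ?case
      by (simp add: S_def vop_sf_const vop_sf_const_times vop_hcoeff[OF assms] algebra_simps)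
  next
    case (add f g)
    have "S n m (f + g) = S n m f + S n m g" by (simp add: S_def vop_add)
    then show ?case by (simp add: add)
  next
    case (mult k f)
    have ee: "of_int e * (of_int e * x) = x" for x :: symfun
      using assms by (auto simp: abs_if split: if_splits)
    have oe: "vop e n (of_int e * f) = of_int e * vop e n f" for n f
      using vop_sf_const_times[of e n "of_int e" f] by (simp add: sf_const_def)
    let ?k = "int (Suc k)"
    have "S n m (psum (Suc k) * f) = psum (Suc k) * S n m f
       - of_int e * (S (n - ?k) m f + S (n + ?k) m f + S n (m - ?k) f + S n (m + ?k) f)"
      by (simp only: S_def vop_psum_times vop_diff vop_add oe) (simp add: algebra_simps del: of_nat_Suc)
    then show ?case by (simp only: mult) simp
  qed
  then show ?thesis by (simp add: S_def)
qed

section \<open>The mixed anticommutation relation\<close>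

lemma hcoeff_convolution:
  assumes "finite A" "{0..t} \<subseteq> A"
  shows "(\<Sum>j\<in>A. hcoeff 1 j * hcoeff (- 1) (t - j)) = (if t = 0 then 1 else 0)"
proof -
  have "(\<Sum>j\<in>A. hcoeff 1 j * hcoeff (- 1) (t - j)) = (\<Sum>j\<in>{0..t}. hcoeff 1 j * hcoeff (- 1) (t - j))"
    by (rule sum.mono_neutral_right) (use assms in \<open>auto simp: hcoeff_def\<close>)
  also have "\<dots> = (if t = 0 then 1 else 0)"
  proof (cases "t < 0")
    case False
    then obtain n where n: "t = int n" by (metis not_less nonneg_int_cases)
    have "(\<Sum>j\<in>{0..t}. hcoeff 1 j * hcoeff (- 1) (t - j))
        = (\<Sum>i=0..n. hcoeff 1 (int i) * hcoeff (- 1) (t - int i))"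
      unfolding n by (rule sum.reindex_bij_witness[of _ int nat]) auto
    also have "\<dots> = fps_nth (exp_series 1 * exp_series (- 1)) n"
      unfolding fps_mult_nth
      by (rule sum.cong[OF refl]) (use n in \<open>auto simp: hcoeff_def nat_diff_distrib\<close>)
    finally show ?thesis by (simp add: exp_series_inverse n)
  qed simp
  finally show ?thesis .
qed

text \<open>Subtracting the term with index \<open>m - 2\<close> replaces
  \<open>cheb (l + 2)\<close> by its difference with \<open>cheb l\<close>, that is by
  \<open>zpair (l + 2)\<close>. The two sums collect the powers z^-l for l >= 0 and z^l for l >=
  1.\<close>

lemma zcoeff_shift_hom_diff:
  assumes "m \<le> int N + 2" and e: "\<bar>e\<bar> = 1"
  shows "zcoeff d n (shift_hom e (hcoeff e m - hcoeff e (m - 2)))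
    = (\<Sum>l\<le>N + 2. hcoeff e (m - int l) * hcoeff d (n + int l))
      + (\<Sum>l\<le>N + 1. hcoeff e (m - 1 - int l) * hcoeff d (n - 1 - int l))"
proof -
  let ?C = "\<lambda>l. zcoeff d n (cheb l)"
  have s: "zcoeff d n (shift_hom e (hcoeff e k)) = (\<Sum>l\<le>M. hcoeff e (k - int l) * ?C l)" if "k \<le> int M" for k M
    by (simp add: shift_hom_hcoeff'[OF e that] zcoeff_sum zcoeff_zconst_times)
  have "zcoeff d n (shift_hom e (hcoeff e m - hcoeff e (m - 2)))
      = (\<Sum>l\<le>N + 2. hcoeff e (m - int l) * ?C l) - (\<Sum>l\<le>N. hcoeff e (m - 2 - int l) * ?C l)"
    using s[of m "N + 2"] s[of "m - 2" N] assms(1) by (simp add: shift_hom.hom_minus zcoeff_diff)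
  also have "(\<Sum>l\<le>N + 2. hcoeff e (m - int l) * ?C l)
      = hcoeff e m * ?C 0 + hcoeff e (m - 1) * ?C 1 + (\<Sum>l\<le>N. hcoeff e (m - 2 - int l) * ?C (Suc (Suc l)))"
    by (simp add: sum.atMost_Suc_shift add.assoc diff_diff_eq del: sum.atMost_Suc cheb.simps)
  also have "\<dots> - (\<Sum>l\<le>N. hcoeff e (m - 2 - int l) * ?C l)
      = hcoeff e m * ?C 0 + hcoeff e (m - 1) * ?C 1
        + (\<Sum>l\<le>N. hcoeff e (m - 2 - int l) * (?C (Suc (Suc l)) - ?C l))"
    by (simp add: right_diff_distrib sum_subtractf del: cheb.simps)
  also have "\<dots> = hcoeff e m * hcoeff d n + hcoeff e (m - 1) * (hcoeff d (n - 1) + hcoeff d (n + 1))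
        + (\<Sum>l\<le>N. hcoeff e (m - 2 - int l) * (hcoeff d (n - 2 - int l) + hcoeff d (n + 2 + int l)))"
    unfolding zcoeff_diff[symmetric] cheb_diff zcoeff_zpair by (simp add: zcoeff_zpair algebra_simps)
  also have "\<dots> = (\<Sum>l\<le>N + 2. hcoeff e (m - int l) * hcoeff d (n + int l))
      + (\<Sum>l\<le>N + 1. hcoeff e (m - 1 - int l) * hcoeff d (n - 1 - int l))"
    by (simp add: sum.atMost_Suc_shift del: sum.atMost_Suc) (simp add: algebra_simps sum.distrib)
  finally show ?thesis .
qed

lemma Ystar_hcoeff:
  assumes "n \<le> int N"
  shows "Ystar m (hcoeff 1 n) = (\<Sum>l\<le>N. hcoeff 1 (n - int l) * (hcoeff (- 1) (m + int l) - hcoeff (- 1) (m - int l - 2)))"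
proof -
  have "Ystar m (hcoeff 1 n) = zcoeff (- 1) m ((1 - zpow 2) * shift_hom 1 (hcoeff 1 n))"
    by (simp add: Ystar_eq_vop vop_def left_diff_distrib zcoeff_diff zcoeff_zpow_times)
  also have "(1 - zpow 2) * shift_hom 1 (hcoeff 1 n)
      = (\<Sum>l\<le>N. zconst (hcoeff 1 (n - int l)) * (zpow (- int l) - zpow (int l + 2)))"
    using shift_hom_hcoeff'[of 1, OF _ assms]
    by (simp only: sum_distrib_left mult.left_commute[of "1 - zpow 2"] cheb_closed abs_one)
  also have "zcoeff (- 1) m \<dots> = (\<Sum>l\<le>N. hcoeff 1 (n - int l) * (hcoeff (- 1) (m + int l) - hcoeff (- 1) (m - int l - 2)))"
    by (simp add: zcoeff_sum zcoeff_zconst_times zcoeff_diff zcoeff_single diff_diff_eq)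
  finally show ?thesis .
qed

text \<open>Each product gives two sums. One from each cancels, and the remaining two are
  complementary halves of the convolution of the two inverse series.\<close>

lemma mixed_vacuum: "Y m (Ystar n 1) + Ystar (n + 1) (Y (m + 1) 1) = (if m = n then 1 else 0)"
proof -
  \<comment> \<open>Large enough for every truncation below to contain all nonzero terms.\<close>
  define N where "N = nat (\<bar>m\<bar> + \<bar>n\<bar>)"
  let ?h = "hcoeff 1" and ?a = "hcoeff (- 1)"
  have N: "n \<le> int N + 2" "- m - 1 \<le> int (N + 1)" "- m \<le> int N" "n \<le> int N" by (auto simp: N_def)
  have "Ystar n 1 = ?a n - ?a (n - 2)" by (simp add: Ystar_eq_vop vop_1)
  then have 1: "Y m (Ystar n 1) = (\<Sum>l\<le>N + 2. ?a (n - int l) * ?h (- m + int l))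
      + (\<Sum>l\<le>N + 1. ?a (n - 1 - int l) * ?h (- m - 1 - int l))"
    using zcoeff_shift_hom_diff[OF N(1), of "- 1" 1 "- m"] by (simp add: Y_eq_vop vop_def)
  have 2: "Ystar (n + 1) (Y (m + 1) 1)
      = (\<Sum>l\<le>N + 1. ?h (- m - 1 - int l) * (?a (n + 1 + int l) - ?a (n + 1 - int l - 2)))"
    using Ystar_hcoeff[OF N(2), of "n + 1"] by (simp add: Y_eq_vop vop_1)
  have 3: "(\<Sum>l\<le>N + 2. ?a (n - int l) * ?h (- m + int l)) = (\<Sum>j\<in>{- m..- m + int (N + 2)}. ?h j * ?a (n - m - j))"
    by (rule sum.reindex_bij_witness[of _ "\<lambda>j. nat (j + m)" "\<lambda>l. - m + int l"]) (auto simp: mult.commute)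
  have 4: "(\<Sum>l\<le>N + 1. ?h (- m - 1 - int l) * ?a (n + 1 + int l)) = (\<Sum>j\<in>{- m - 1 - int (N + 1)..- m - 1}. ?h j * ?a (n - m - j))"
    by (rule sum.reindex_bij_witness[of _ "\<lambda>j. nat (- m - 1 - j)" "\<lambda>l. - m - 1 - int l"])
       (auto simp: algebra_simps)
  \<comment> \<open>The sums in which both indices decrease with \<open>l\<close> are the ones that
    cancel.\<close>
  have "Y m (Ystar n 1) + Ystar (n + 1) (Y (m + 1) 1)
     = (\<Sum>l\<le>N + 2. ?a (n - int l) * ?h (- m + int l)) + (\<Sum>l\<le>N + 1. ?h (- m - 1 - int l) * ?a (n + 1 + int l))"
  proof -
    have "n + 1 - int l - 2 = n - 1 - int l" for l by simp
    then show ?thesis unfolding 1 2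
      by (simp only: right_diff_distrib sum_subtractf mult.commute[of "?h _"]) simp
  qed
  \<comment> \<open>The ranges meet without overlap between \<open>- m - 1\<close> and
    \<open>- m\<close>.\<close>
  also have "\<dots> = (\<Sum>j\<in>{- m..- m + int (N + 2)} \<union> {- m - 1 - int (N + 1)..- m - 1}. ?h j * ?a (n - m - j))"
    unfolding 3 4 by (rule sum.union_disjoint[symmetric]) auto
  also have "\<dots> = (if n - m = 0 then 1 else 0)"
    by (rule hcoeff_convolution) (use N in auto)
  finally show ?thesis by auto
qed

lemma Y_add: "Y n (f + g) = Y n f + Y n g"
  by (simp add: Y_eq_vop vop_add)

lemma Y_uminus: "Y n (- f) = - Y n f"
  by (simp add: Y_eq_vop vop_uminus)

lemma Y_diff: "Y n (f - g) = Y n f - Y n g"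
  by (simp add: Y_eq_vop vop_diff)

lemma Ystar_add: "Ystar n (f + g) = Ystar n f + Ystar n g"
  by (simp add: Ystar_eq_vop vop_add)

lemma Ystar_uminus: "Ystar n (- f) = - Ystar n f"
  by (simp add: Ystar_eq_vop vop_uminus)

lemma Ystar_diff: "Ystar n (f - g) = Ystar n f - Ystar n g"
  by (simp add: Ystar_eq_vop vop_diff)

lemma Y_Y: "Y (m + 1) (Y n f) = - Y (n + 1) (Y m f)"
  using vop_exchange[of 1 "- m" "- n" f] by (simp add: Y_eq_vop eq_neg_iff_add_eq_0)

lemma Y_Ystar: "Y m (Ystar n f) + Ystar (n + 1) (Y (m + 1) f) = (if m = n then f else 0)"
proof -
  define R where "R m n f = Y m (Ystar n f) + Ystar (n + 1) (Y (m + 1) f)" for m n f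
  have "R m n f = (if m = n then f else 0)"
  proof (induction f arbitrary: n m rule: symfun_induct)
    case (const c)
    have "R m n (sf_const c * 1) = sf_const c * R m n 1"
      by (simp only: R_def Y_eq_vop Ystar_eq_vop vop_sf_const_times vop_diff right_diff_distrib distrib_left)
    then show ?case using mixed_vacuum[of m n] by (simp add: R_def)
  next
    case (add f g)
    have "R m n (f + g) = R m n f + R m n g" by (simp add: R_def Y_add Ystar_add)
    then show ?case by (simp add: add)
  next
    case (mult k f)
    let ?k = "int (Suc k)" and ?p = "psum (Suc k)"
    have Y: "Y n (?p * f) = ?p * Y n f - Y (n - ?k) f - Y (n + ?k) f" for n f
      by (simp only: Y_eq_vop vop_psum_times) (simp add: algebra_simps del: of_nat_Suc)
    have Ys: "Ystar n (?p * f) = ?p * Ystar n f + Ystar (n - ?k) f + Ystar (n + ?k) f" for n f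
      by (simp only: Ystar_eq_vop vop_psum_times) (simp add: algebra_simps del: of_nat_Suc)
    \<comment> \<open>By induction each bracket is a difference of two equal terms: for instance
      \<open>m = n - ?k\<close> holds exactly when \<open>m + ?k = n\<close>.\<close>
    have "R m n (?p * f) = ?p * R m n f + (R m (n - ?k) f - R (m + ?k) n f) + (R m (n + ?k) f - R (m - ?k) n f)"
      by (simp only: R_def Y Ys Y_diff Ystar_diff Y_add Ystar_add) (simp add: algebra_simps del: of_nat_Suc)
    then show ?case by (simp only: mult) auto
  qed
  then show ?thesis by (simp add: R_def)
qed

section \<open>Determinants\<close>

text \<open>Because \<open>i\<close> is subtracted in row \<open>i\<close>, prepending an entry
  lowers the index of every old row by one, as happens with \<open>r (m - 1)\<close> in the next
  lemma.\<close>

definition row_det :: "(int \<Rightarrow> nat \<Rightarrow> 'a::comm_ring_1) \<Rightarrow> int list \<Rightarrow> 'a" where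
  "row_det r ns = det (mat (length ns) (length ns) (\<lambda>(i, j). r (ns ! i - int i) j))"

lemma row_det_Nil [simp]: "row_det r [] = 1"
  by (simp add: row_det_def)

interpretation zconst: comm_ring_hom zconst
  by unfold_locales (simp_all add: single_add mult_single)

text \<open>
  The row \<open>v\<close> is annihilated, except in column 0, by the column operations that turn the rows \<open>r (m - 1)\<close>
  into the images of the rows \<open>r m\<close>. So the image of the determinant is the determinant with the extra
  row \<open>v\<close> on top, and expanding along \<open>v\<close> allows its coefficients to be read off entrywise.
\<close>

lemma zcoeff_row_det:
  fixes r :: "int \<Rightarrow> nat \<Rightarrow> symfun"
  assumes shift: "\<And>m j. shift_hom d (r m j) = zconst (r (m - 1) (Suc j)) - zpair 1 * zconst (r (m - 1) j)
      + (if j = 0 then 0 else t j * zconst (r (m - 1) (j - 1)))"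
    and v_0: "v 0 = 1"
    and v_Suc: "\<And>j. v (Suc j) = zpair 1 * v j - (if j = 0 then 0 else t j * v (j - 1))"
    and coeff: "\<And>n j. zcoeff e n (w * v j) = r n j"
  shows "zcoeff e n (w * shift_hom d (row_det r ns)) = row_det r (n # ns)"
proof -
  define k where "k = length ns"
  define N where "N = mat (Suc k) (Suc k) (\<lambda>(i, j). r ((n # ns) ! i - int i) j)"
  define M where "M = mat (Suc k) (Suc k) (\<lambda>(i, j). if i = 0 then v j else zconst (N $$ (i, j)))"
  \<comment> \<open>Right multiplication by this unitriangular band matrix performs the column
    operations encoded in \<open>shift\<close> and \<open>v_Suc\<close>.\<close>
  define U where "U = mat (Suc k) (Suc k) (\<lambda>(i, j). if i = j then 1 else if j = Suc i then - zpair 1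
     else if j = Suc (Suc i) then t (Suc i) else 0)"
  have carrier: "N \<in> carrier_mat (Suc k) (Suc k)" "M \<in> carrier_mat (Suc k) (Suc k)"
    "U \<in> carrier_mat (Suc k) (Suc k)" "M * U \<in> carrier_mat (Suc k) (Suc k)"
    by (auto simp: N_def M_def U_def intro!: mult_carrier_mat)
  have "det U = prod_list (diag_mat U)"
    by (rule det_upper_triangular[OF _ carrier(3)]) (auto simp: U_def)
  also have "\<dots> = 1"
    unfolding prod_list_diag_prod by (rule prod.neutral) (auto simp: U_def)
  finally have det_MU: "det (M * U) = det M"
    by (simp add: det_mult[OF carrier(2,3)])
  have MU: "(M * U) $$ (i, j) = (\<Sum>l<Suc k. M $$ (i, l) * U $$ (l, j))" if "i < Suc k" "j < Suc k" for i j
    using carrier that by (simp add: times_mat_def scalar_prod_def lessThan_atLeast0 del: sum.lessThan_Suc sum.op_ivl_Suc)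
  have MU_0: "(M * U) $$ (i, 0) = M $$ (i, 0)" if "i < Suc k" for i
  proof -
    have "(\<Sum>l<Suc k. M $$ (i, l) * U $$ (l, 0)) = (\<Sum>l\<in>{0}. M $$ (i, l) * U $$ (l, 0))"
      by (rule sum.mono_neutral_right) (auto simp: U_def)
    then show ?thesis using MU[OF that, of 0] by (simp add: U_def)
  qed
  have MU_Suc: "(M * U) $$ (i, Suc j) = M $$ (i, Suc j) - zpair 1 * M $$ (i, j)
      + (if j = 0 then 0 else t j * M $$ (i, j - 1))" if "i < Suc k" "Suc j < Suc k" for i j
  proof -
    have "(\<Sum>l<Suc k. M $$ (i, l) * U $$ (l, Suc j))
        = (\<Sum>l\<in>{Suc j, j} \<union> (if j = 0 then {} else {j - 1}). M $$ (i, l) * U $$ (l, Suc j))"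
      by (rule sum.mono_neutral_right) (use that in \<open>auto simp: U_def split: if_splits\<close>)
    also have "\<dots> = M $$ (i, Suc j) - zpair 1 * M $$ (i, j) + (if j = 0 then 0 else t j * M $$ (i, j - 1))"
      using that by (cases j) (simp_all add: U_def algebra_simps)
    finally show ?thesis using MU[OF that] by simp
  qed
  have row0: "(M * U) $$ (0, j) = (if j = 0 then 1 else 0)" if "j < Suc k" for j
  proof (cases j)
    case 0
    then show ?thesis using MU_0[of 0] by (simp add: M_def v_0)
  next
    case (Suc i)
    then show ?thesis using that MU_Suc[of 0 i] by (simp add: M_def v_Suc del: One_nat_def)
  qed
  have "det (M * U) = (\<Sum>j<Suc k. (M * U) $$ (0, j) * cofactor (M * U) 0 j)"
    by (rule laplace_expansion_row[OF carrier(4)]) simp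
  also have "\<dots> = (\<Sum>j<Suc k. if j = 0 then cofactor (M * U) 0 0 else 0)"
    by (rule sum.cong) (auto simp: row0)
  also have "\<dots> = det (mat_delete (M * U) 0 0)" by (simp add: cofactor_def del: sum.lessThan_Suc)
  \<comment> \<open>Below the cleared top row and beside column 0, the product is the entrywise
    image of the smaller matrix.\<close>
  also have "mat_delete (M * U) 0 0 = map_mat (shift_hom d) (mat k k (\<lambda>(i, j). r (ns ! i - int i) j))"
  proof (rule eq_matI)
    fix i j assume "i < dim_row (map_mat (shift_hom d) (mat k k (\<lambda>(i, j). r (ns ! i - int i) j)))"
      "j < dim_col (map_mat (shift_hom d) (mat k k (\<lambda>(i, j). r (ns ! i - int i) j)))"
    then have ij: "i < k" "j < k" by simp_all
    have "mat_delete (M * U) 0 0 $$ (i, j) = (M * U) $$ (Suc i, Suc j)"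
      using mat_delete_index[OF carrier(4), of 0 0 i j] ij by (simp add: insert_index_def)
    also have "\<dots> = shift_hom d (r (ns ! i - int i) j)"
      using ij by (subst MU_Suc) (simp_all add: shift M_def N_def diff_diff_eq add.commute)
    finally show "mat_delete (M * U) 0 0 $$ (i, j)
        = map_mat (shift_hom d) (mat k k (\<lambda>(i, j). r (ns ! i - int i) j)) $$ (i, j)"
      using ij by simp
  qed (use carrier in \<open>simp_all add: mat_delete_def\<close>)
  also have "det \<dots> = shift_hom d (row_det r ns)"
    by (simp add: shift_hom.hom_det row_det_def k_def)
  finally have "shift_hom d (row_det r ns) = det M" by (simp add: det_MU)
  also have "\<dots> = (\<Sum>j<Suc k. M $$ (0, j) * cofactor M 0 j)"
    by (rule laplace_expansion_row[OF carrier(2)]) simp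
  also have "\<dots> = (\<Sum>j<Suc k. v j * zconst (cofactor N 0 j))"
  proof (rule sum.cong[OF refl])
    fix j assume "j \<in> {..<Suc k}"
    then have j: "j < Suc k" by simp
    \<comment> \<open>Only the top row of \<open>M\<close> involves z, so its cofactors along that
      row are constants and the coefficient can be read off entry by entry.\<close>
    have "mat_delete M 0 j = map_mat zconst (mat_delete N 0 j)"
    proof (rule eq_matI)
      fix i l assume "i < dim_row (map_mat zconst (mat_delete N 0 j))" "l < dim_col (map_mat zconst (mat_delete N 0 j))"
      then have il: "i < k" "l < k" using carrier(1) by (simp_all add: mat_delete_def)
      then have "insert_index j l < Suc k" by (simp add: insert_index_def)
      then show "mat_delete M 0 j $$ (i, l) = map_mat zconst (mat_delete N 0 j) $$ (i, l)"
        using mat_delete_index[OF carrier(2), of 0 j i l] mat_delete_index[OF carrier(1), of 0 j i l] il j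
          carrier(1) mat_delete_carrier[OF carrier(1), of 0 j]
        by (simp add: M_def insert_index_def[of 0])
    qed (use carrier in \<open>simp_all add: mat_delete_def\<close>)
    then have "cofactor M 0 j = zconst (cofactor N 0 j)"
      by (simp only: cofactor_def zconst.hom_det zconst.hom_mult zconst.hom_power zconst.hom_uminus zconst.hom_one)
    then show "M $$ (0, j) * cofactor M 0 j = v j * zconst (cofactor N 0 j)"
      using j by (simp add: M_def)
  qed
  finally have "w * shift_hom d (row_det r ns) = (\<Sum>j<Suc k. zconst (cofactor N 0 j) * (w * v j))"
    by (simp only: sum_distrib_left mult_ac)
  then have "zcoeff e n (w * shift_hom d (row_det r ns)) = (\<Sum>j<Suc k. cofactor N 0 j * r n j)"
    by (simp only: zcoeff_sum zcoeff_zconst_times coeff)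
  also have "\<dots> = (\<Sum>j<Suc k. N $$ (0, j) * cofactor N 0 j)"
    by (rule sum.cong) (auto simp: N_def mult.commute)
  also have "\<dots> = det N" by (rule laplace_expansion_row[OF carrier(1), symmetric]) simp
  finally show ?thesis by (simp add: row_det_def N_def k_def)
qed

text \<open>Column 0 is half of the corresponding column in \<open>sp\<close>, which absorbs the
  factor 1/2 there and matches a top row starting with 1.\<close>

definition sp_row :: "int \<Rightarrow> nat \<Rightarrow> symfun" where
  "sp_row m j = (if j = 0 then hcoeff 1 m else hcoeff 1 (m + int j) + hcoeff 1 (m - int j))"

definition e_row :: "int \<Rightarrow> nat \<Rightarrow> symfun" where
  "e_row m j = hcoeff (- 1) (m + int j) - hcoeff (- 1) (m - int j - 2)"

lemma Y_row_det: "Y (- n) (row_det sp_row ns) = row_det sp_row (n # ns)"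
proof -
  \<comment> \<open>The value 2 of \<open>?t\<close> at \<open>j = 1\<close> compensates for
    \<open>?v 0 = 1\<close> standing where \<open>zpair 0 = 2\<close> would fit the
    recursion.\<close>
  let ?v = "\<lambda>j. if j = 0 then 1 else zpair j" and ?t = "\<lambda>j. if j = 1 then 2 else (1 :: laurent_poly)"
  have h: "shift_hom (- 1) (hcoeff 1 m) = zconst (hcoeff 1 m) - zpair 1 * zconst (hcoeff 1 (m - 1)) + zconst (hcoeff 1 (m - 2))" for m
    by (rule shift_hom_hcoeff) simp
  have "zcoeff 1 n (1 * shift_hom (- 1) (row_det sp_row ns)) = row_det sp_row (n # ns)"
  proof (rule zcoeff_row_det[where v = ?v and t = ?t])
    fix m j
    consider "j = 0" | "j = 1" | i where "j = Suc (Suc i)"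
      by (metis One_nat_def not0_implies_Suc)
    then show "shift_hom (- 1) (sp_row m j) = zconst (sp_row (m - 1) (Suc j)) - zpair 1 * zconst (sp_row (m - 1) j)
      + (if j = 0 then 0 else ?t j * zconst (sp_row (m - 1) (j - 1)))"
      by cases (simp_all add: sp_row_def h shift_hom_add single_add distrib_left add_ac diff_diff_eq
          del: One_nat_def)
  next
    fix j
    consider "j = 0" | "j = 1" | i where "j = Suc (Suc i)"
      by (metis One_nat_def not0_implies_Suc)
    then show "?v (Suc j) = zpair 1 * ?v j - (if j = 0 then 0 else ?t j * ?v (j - 1))"
    proof cases
      case 2
      then show ?thesis using zpair_Suc_Suc[of 0] by (simp add: zpair_def[of 0])
    next
      case (3 i)
      then show ?thesis using zpair_Suc_Suc[of "Suc i"] by simp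
    qed simp
  next
    fix n j
    show "zcoeff 1 n (1 * ?v j) = sp_row n j"
      by (simp add: sp_row_def zcoeff_zpair add.commute)
  qed simp
  then show ?thesis by (simp add: Y_eq_vop vop_def)
qed

lemma Ystar_row_det: "Ystar n (row_det e_row ns) = row_det e_row (n # ns)"
proof -
  have h: "shift_hom 1 (hcoeff (- 1) m) = zconst (hcoeff (- 1) m) - zpair 1 * zconst (hcoeff (- 1) (m - 1)) + zconst (hcoeff (- 1) (m - 2))" for m
    by (rule shift_hom_hcoeff) simp
  have "zcoeff (- 1) n ((1 - zpow 2) * shift_hom 1 (row_det e_row ns)) = row_det e_row (n # ns)"
  proof (rule zcoeff_row_det[where v = cheb and t = "\<lambda>_. 1"])
    fix m j
    show "shift_hom 1 (e_row m j) = zconst (e_row (m - 1) (Suc j)) - zpair 1 * zconst (e_row (m - 1) j)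
      + (if j = 0 then 0 else 1 * zconst (e_row (m - 1) (j - 1)))"
      by (cases j) (simp_all add: e_row_def h shift_hom.hom_minus single_diff algebra_simps del: One_nat_def)
  next
    fix j
    show "cheb (Suc j) = zpair 1 * cheb j - (if j = 0 then 0 else 1 * cheb (j - 1))"
      by (cases j) simp_all
  next
    fix n j
    show "zcoeff (- 1) n ((1 - zpow 2) * cheb j) = e_row n j"
      by (simp add: cheb_closed zcoeff_diff zcoeff_single e_row_def diff_diff_eq)
  qed simp
  then show ?thesis
    by (simp add: Ystar_eq_vop vop_def left_diff_distrib zcoeff_diff zcoeff_zpow_times)
qed

section \<open>Operator products on 1 as determinants\<close>

lemma foldr_Ystar: "foldr Ystar ns 1 = row_det e_row ns"
  by (induction ns) (simp_all add: Ystar_row_det)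

lemma foldr_Y: "foldr Y (map uminus ns) 1 = row_det sp_row ns"
  by (induction ns) (simp_all add: Y_row_det)

text \<open>In the Leibniz expansion every permutation collects each row factor and each column
  factor exactly once.\<close>

lemma det_scale_rows_cols:
  fixes A :: "'a::comm_ring_1 mat"
  assumes "A \<in> carrier_mat n n"
  shows "det (mat n n (\<lambda>(i, j). a i * b j * A $$ (i, j))) = prod a {0..<n} * prod b {0..<n} * det A"
proof -
  let ?B = "mat n n (\<lambda>(i, j). a i * b j * A $$ (i, j))"
  have *: "(\<Prod>i = 0..<n. ?B $$ (i, p i)) = prod a {0..<n} * prod b {0..<n} * (\<Prod>i = 0..<n. A $$ (i, p i))"
    if p: "p permutes {0..<n}" for p
  proof -
    have "(\<Prod>i = 0..<n. ?B $$ (i, p i)) = (\<Prod>i = 0..<n. a i * b (p i) * A $$ (i, p i))"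
      by (rule prod.cong) (use permutes_in_image[OF p] in auto)
    also have "\<dots> = prod a {0..<n} * (\<Prod>i = 0..<n. b (p i)) * (\<Prod>i = 0..<n. A $$ (i, p i))"
      by (simp only: prod.distrib)
    also have "(\<Prod>i = 0..<n. b (p i)) = prod b {0..<n}"
      using prod.permute[OF p, of b] by (simp add: o_def)
    finally show ?thesis .
  qed
  have "det ?B = (\<Sum>p\<in>{p. p permutes {0..<n}}. of_int (sign p) * (\<Prod>i = 0..<n. ?B $$ (i, p i)))"
    by (rule det_def') simp
  also have "\<dots> = (\<Sum>p\<in>{p. p permutes {0..<n}}. prod a {0..<n} * prod b {0..<n} *
      (of_int (sign p) * (\<Prod>i = 0..<n. A $$ (i, p i))))"
  proof (rule sum.cong[OF refl])
    fix p assume "p \<in> {p. p permutes {0..<n}}"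
    then show "of_int (sign p) * (\<Prod>i = 0..<n. ?B $$ (i, p i)) = prod a {0..<n} * prod b {0..<n} *
      (of_int (sign p) * (\<Prod>i = 0..<n. A $$ (i, p i)))"
      by (simp only: mem_Collect_eq *) (simp only: mult.left_commute)
  qed
  also have "\<dots> = prod a {0..<n} * prod b {0..<n} * det A"
    unfolding det_def'[OF assms] by (simp only: sum_distrib_left)
  finally show ?thesis .
qed

text \<open>The sign relating \<open>hcoeff (- 1)\<close> to \<open>esym\<close> splits into row
  signs for \<open>lam ! i\<close> and \<open>i\<close> and column signs for \<open>j\<close>. The
  last two cancel in the product over the matrix.\<close>

lemma foldr_Ystar_partition: "foldr Ystar (map int lam) 1 = (-1) ^ sum_list lam * e_det lam"
proof -
  let ?k = "length lam" and ?s = "\<lambda>n. (- 1 :: symfun) ^ n"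
  let ?A = "mat ?k ?k (\<lambda>(i, j). esym (int (lam ! i) - int i + int j) - esym (int (lam ! i) - int i - int j - 2))"
  have ss: "?s n * ?s n = 1" for n by (cases "even n") simp_all
  have hc: "hcoeff (- 1) m = ?s (nat m) * esym m" for m
    by (simp only: esym_eq_hcoeff mult.assoc[symmetric] ss mult_1)
  have sgn: "?s (nat m) * x = ?s a * x" if "even (m - int a)" "m \<ge> 0" for m a and x :: symfun
  proof -
    have "even (nat m) \<longleftrightarrow> even a" using that by (auto simp: even_nat_iff)
    then show ?thesis by (cases "even a") simp_all
  qed
  \<comment> \<open>For negative \<open>m\<close> the exponent \<open>nat m\<close> loses its
    parity, but then both sides are 0.\<close>
  have ent: "hcoeff (- 1) m = ?s a * esym m" if "even (m - int a)" for m a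
    using sgn[OF that] hc[of m] by (cases "m \<ge> 0") (simp_all add: esym_def)
  have "e_row (int (lam ! i) - int i) j = ?s (lam ! i) * ?s i * ?s j * ?A $$ (i, j)" if "i < ?k" "j < ?k" for i j
    using that ent[of "int (lam ! i) - int i + int j" "lam ! i + i + j"]
      ent[of "int (lam ! i) - int i - int j - 2" "lam ! i + i + j"]
    by (simp add: e_row_def power_add right_diff_distrib)
  then have "mat ?k ?k (\<lambda>(i, j). e_row (map int lam ! i - int i) j)
      = mat ?k ?k (\<lambda>(i, j). (?s (lam ! i) * ?s i) * ?s j * ?A $$ (i, j))"
    by (intro eq_matI) simp_all
  then have "foldr Ystar (map int lam) 1
      = (\<Prod>i = 0..<?k. ?s (lam ! i) * ?s i) * prod ?s {0..<?k} * e_det lam"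
    unfolding foldr_Ystar row_det_def e_det_def length_map
    by (simp only:) (rule det_scale_rows_cols, simp)
  also have "(\<Prod>i = 0..<?k. ?s (lam ! i) * ?s i) * prod ?s {0..<?k} = (\<Prod>i = 0..<?k. ?s (lam ! i))"
    by (simp only: prod.distrib[symmetric] mult.assoc ss mult_1_right)
  also have "\<dots> = ?s (sum_list lam)"
    by (simp add: power_sum[symmetric] sum_list_sum_nth)
  finally show ?thesis .
qed

text \<open>Doubling column 0 cancels the factor 1/2. A nonempty list guarantees that this column
  exists.\<close>

lemma sp_eq_foldr_Y:
  assumes "lam \<noteq> []"
  shows "sp lam = foldr Y (map (\<lambda>l. - int l) lam) 1"
proof -
  let ?k = "length lam" and ?b = "\<lambda>j. if j = 0 then 2 else (1 :: symfun)"
  let ?A = "mat ?k ?k (\<lambda>(i, j). sp_row (map int lam ! i - int i) j)"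
  have "mat ?k ?k (\<lambda>(i, j). hsym (int (lam ! i) - int i + int j) + hsym (int (lam ! i) - int i - int j))
      = mat ?k ?k (\<lambda>(i, j). 1 * ?b j * ?A $$ (i, j))"
    by (intro eq_matI) (auto simp: sp_row_def hsym_eq_hcoeff)
  then have "sp lam = sf_const (1 / 2) * ((\<Prod>i = 0..<?k. 1) * prod ?b {0..<?k} * det ?A)"
    unfolding sp_def by (simp only:) (subst det_scale_rows_cols, simp_all)
  also have "prod ?b {0..<?k} = 2"
    using assms by (subst prod.delta) simp_all
  also have "sf_const (1 / 2) * ((\<Prod>i = 0..<?k. 1) * 2 * det ?A) = det ?A"
  proof -
    have "sf_const (1 / 2) * 2 = 1"
      using of_nat_times_sf_const_inverse[of 2] by (simp add: mult.commute)
    then show ?thesis by (simp add: mult.assoc[symmetric])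
  qed
  also have "\<dots> = foldr Y (map uminus (map int lam)) 1"
    unfolding foldr_Y row_det_def length_map ..
  finally show ?thesis by (simp add: o_def)
qed

section \<open>Wedges and partitions\<close>

text \<open>The tail has charge \<open>N + int (length xs)\<close>, so the index at the head is that
  of \<psi> at site \<open>x\<close>.\<close>

fun wedge_list :: "int \<Rightarrow> int list \<Rightarrow> symfun" where
  "wedge_list N [] = 1"
| "wedge_list N (x # xs) = Y (N + int (length xs) - x) (wedge_list N xs)"

text \<open>
  The semi-infinite wedge whose occupied sites are \<open>A\<close> and all sites below \<open>N\<close>; its charge is
  \<open>N + card A\<close>.
\<close>

definition wedge :: "int \<Rightarrow> int set \<Rightarrow> symfun" where
  "wedge N A = wedge_list N (rev (sorted_list_of_set A))"

lemma wedge_empty [simp]: "wedge N {} = 1"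
  by (simp add: wedge_def)

lemma wedge_insert_greatest:
  assumes "finite A" "\<And>x. x \<in> A \<Longrightarrow> x < b"
  shows "wedge N (insert b A) = Y (N + int (card A) - b) (wedge N A)"
proof -
  have "sorted_list_of_set (insert b A) = sorted_list_of_set A @ [b]"
    by (rule sorted_distinct_set_unique)
       (use assms in \<open>auto simp: sorted_append less_imp_le simp del: sorted_list_of_set_insert_remove\<close>)
  then show ?thesis by (simp add: wedge_def)
qed

lemma minus_one_power_times: "(- 1) ^ n * f = (if even n then f else - f)" for f :: symfun
  by simp

lemma Y_sign: "Y m ((- 1) ^ n * f) = (- 1) ^ n * Y m f"
  by (simp add: minus_one_power_times Y_uminus)

lemma Ystar_sign: "Ystar m ((- 1) ^ n * f) = (- 1) ^ n * Ystar m f"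
  by (simp add: minus_one_power_times Ystar_uminus)

lemma Y_0 [simp]: "Y m 0 = 0"
  using Y_diff[of m 0 0] by simp

text \<open>The new site is moved inwards past each greater occupied one, and every exchange by
  \<open>Y_Y\<close> changes the sign.\<close>

lemma Y_wedge:
  assumes "finite A" "a \<notin> A"
  shows "Y (N + int (card A) - a) (wedge N A) = (- 1) ^ card {x \<in> A. a < x} * wedge N (insert a A)"
  using assms
proof (induction A rule: finite_linorder_max_induct)
  case empty
  then show ?case using wedge_insert_greatest[of "{}" a N] by simp
next
  case (insert b A)
  have "b \<notin> A" using insert by auto
  consider "b < a" | "a < b" using insert by fastforce
  then show ?case
  proof cases
    case 1
    then have *: "x < a" if "x \<in> insert b A" for x using that insert by auto
    then have "{x \<in> insert b A. a < x} = {}" by fastforce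
    then have "card {x \<in> insert b A. a < x} = 0" by (simp only: card.empty)
    moreover have "wedge N (insert a (insert b A)) = Y (N + int (card (insert b A)) - a) (wedge N (insert b A))"
      by (rule wedge_insert_greatest) (use insert * in auto)
    ultimately show ?thesis by (simp only: power_0 mult_1)
  next
    case 2
    have c: "int (card (insert b A)) = int (card A) + 1" using insert \<open>b \<notin> A\<close> by simp
    have "{x \<in> insert b A. a < x} = insert b {x \<in> A. a < x}" using 2 by auto
    then have s: "card {x \<in> insert b A. a < x} = Suc (card {x \<in> A. a < x})"
      using insert \<open>b \<notin> A\<close> by simp
    have w: "wedge N (insert b A) = Y (N + int (card A) - b) (wedge N A)"
      using insert by (intro wedge_insert_greatest) auto
    have w': "wedge N (insert b (insert a A)) = Y (N + int (card A) + 1 - b) (wedge N (insert a A))"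
      using insert 2 by (subst wedge_insert_greatest) (auto simp: add_ac)
    have "Y (N + int (card (insert b A)) - a) (wedge N (insert b A))
        = Y (N + int (card A) - a + 1) (Y (N + int (card A) - b) (wedge N A))"
      unfolding c w by (simp add: algebra_simps)
    also have "\<dots> = - Y (N + int (card A) - b + 1) (Y (N + int (card A) - a) (wedge N A))"
      by (rule Y_Y)
    also have "Y (N + int (card A) - a) (wedge N A) = (- 1) ^ card {x \<in> A. a < x} * wedge N (insert a A)"
      using insert by simp
    also have "- Y (N + int (card A) - b + 1) \<dots>
        = - ((- 1) ^ card {x \<in> A. a < x} * wedge N (insert b (insert a A)))"
      by (simp only: Y_sign w' diff_add_eq)
    finally show ?thesis unfolding s by (simp add: insert_commute)
  qed
qed

lemma Ystar_Y: "Ystar (n + 1) (Y (m + 1) f) = (if m = n then f else 0) - Y m (Ystar n f)"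
  using Y_Ystar[of m n f] by (simp add: eq_diff_eq add.commute)

text \<open>Removal at an empty site anticommutes with all factors until it reaches 1. There its
  index \<open>N - 1 - b\<close> is negative, so the result is 0.\<close>

lemma Ystar_wedge_eq_0:
  assumes "finite A" "b \<notin> A" "N \<le> b"
  shows "Ystar (N + int (card A) - 1 - b) (wedge N A) = 0"
  using assms(1,2)
proof (induction A rule: finite_linorder_max_induct)
  case empty
  then show ?case using assms(3) by (simp add: Ystar_eq_vop vop_1)
next
  case (insert c A)
  have "c \<notin> A" using insert by auto
  have "Ystar (N + int (card (insert c A)) - 1 - b) (wedge N (insert c A))
      = Ystar (N + int (card A) - 1 - b + 1) (Y (N + int (card A) - 1 - c + 1) (wedge N A))"
    using insert \<open>c \<notin> A\<close> by (subst wedge_insert_greatest) (auto simp: algebra_simps)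
  also have "\<dots> = 0" unfolding Ystar_Y using insert by simp
  finally show ?case .
qed

text \<open>The removal anticommutes past the greater sites until it meets \<open>b\<close>. The
  delta term of the mixed relation then deletes \<open>b\<close>, and the other term vanishes
  because \<open>b\<close> is empty below.\<close>

lemma Ystar_wedge:
  assumes "finite A" "b \<in> A" "N \<le> b"
  shows "Ystar (N + int (card A) - 1 - b) (wedge N A) = (- 1) ^ card {x \<in> A. b < x} * wedge N (A - {b})"
  using assms(1,2)
proof (induction A rule: finite_linorder_max_induct)
  case (insert c A)
  have "c \<notin> A" using insert by auto
  have step: "Ystar (N + int (card (insert c A)) - 1 - b) (wedge N (insert c A))
      = Ystar (N + int (card A) - 1 - b + 1) (Y (N + int (card A) - 1 - c + 1) (wedge N A))"
    using insert \<open>c \<notin> A\<close> by (subst wedge_insert_greatest) (auto simp: algebra_simps)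
  show ?case
  proof (cases "b = c")
    case True
    then have "{x \<in> insert c A. b < x} = {}" using insert by fastforce
    then have "card {x \<in> insert c A. b < x} = 0" by (simp only: card.empty)
    moreover have "insert c A - {b} = A" using True \<open>c \<notin> A\<close> by auto
    ultimately show ?thesis unfolding step Ystar_Y
      using True \<open>c \<notin> A\<close> Ystar_wedge_eq_0[OF insert(1) _ assms(3)] by simp
  next
    case False
    then have "b \<in> A" using insert by simp
    then have "b < c" using insert by simp
    have "{x \<in> insert c A. b < x} = insert c {x \<in> A. b < x}" using \<open>b < c\<close> by auto
    then have s: "card {x \<in> insert c A. b < x} = Suc (card {x \<in> A. b < x})"
      using insert \<open>c \<notin> A\<close> by simp
    have "insert c A - {b} = insert c (A - {b})" using False by auto
    moreover have "wedge N (insert c (A - {b})) = Y (N + int (card (A - {b})) - c) (wedge N (A - {b}))"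
      using insert by (intro wedge_insert_greatest) auto
    moreover have "int (card (A - {b})) = int (card A) - 1"
    proof -
      have "card A > 0" using \<open>b \<in> A\<close> insert(1) by (auto simp: card_gt_0_iff)
      then show ?thesis using \<open>b \<in> A\<close> by (simp add: of_nat_diff)
    qed
    ultimately have w: "wedge N (insert c A - {b}) = Y (N + int (card A) - 1 - c) (wedge N (A - {b}))"
      by (simp add: add_diff_eq)
    have "Ystar (N + int (card A) - 1 - b) (wedge N A) = (- 1) ^ card {x \<in> A. b < x} * wedge N (A - {b})"
      using insert \<open>b \<in> A\<close> by simp
    then show ?thesis unfolding step Ystar_Y s w
      using False by (simp add: Y_sign)
  qed
qed simp

text \<open>Each further site contributes \<open>Y 0 1 = 1\<close>. Filling the sites from
  \<open>N\<close> up to \<open>M\<close> only moves the bottom level, so 1 can be read as a wedge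
  with sites available for removal.\<close>

lemma wedge_interval: "N \<le> M \<Longrightarrow> wedge N {N..<M} = 1"
proof (induction M rule: int_ge_induct)
  case (step M)
  have "{N..<M + 1} = insert M {N..<M}" using step by auto
  moreover have "wedge N (insert M {N..<M}) = Y (N + int (card {N..<M}) - M) (wedge N {N..<M})"
    by (rule wedge_insert_greatest) auto
  ultimately show ?case using step by (simp add: Y_eq_vop vop_1)
qed simp

text \<open>The smallest new site is inserted first, so only sites of \<open>A\<close> are crossed.
  The term with \<open>i\<close> in the index counts the sites already inserted when operator
  \<open>i\<close> acts.\<close>

lemma foldr_Y_wedge:
  assumes "finite A" "\<And>i j. i < j \<Longrightarrow> j < r \<Longrightarrow> a j < a i" "\<And>i. i < r \<Longrightarrow> a i \<notin> A"
  shows "foldr Y (map (\<lambda>i. N + int (card A) + (int r - int (Suc i)) - a i) [0..<r]) (wedge N A)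
    = (- 1) ^ (\<Sum>i<r. card {x \<in> A. a i < x}) * wedge N (A \<union> a ` {..<r})"
  using assms(2,3)
proof (induction r arbitrary: a)
  case (Suc r)
  let ?a = "\<lambda>i. a (Suc i)" and ?B = "A \<union> (\<lambda>i. a (Suc i)) ` {..<r}"
  have lt: "?a i < a 0" if "i < r" for i using Suc(2)[of 0 "Suc i"] that by simp
  have inj: "inj_on ?a {..<r}"
  proof (rule inj_onI)
    fix i j assume "i \<in> {..<r}" "j \<in> {..<r}" "a (Suc i) = a (Suc j)"
    then show "i = j"
      using Suc(2)[of "Suc i" "Suc j"] Suc(2)[of "Suc j" "Suc i"] by (cases i j rule: linorder_cases) auto
  qed
  have IH: "foldr Y (map (\<lambda>i. N + int (card A) + (int r - int (Suc i)) - ?a i) [0..<r]) (wedge N A)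
    = (- 1) ^ (\<Sum>i<r. card {x \<in> A. ?a i < x}) * wedge N ?B"
    by (rule Suc(1)) (rule Suc(2) Suc(3); simp)+
  have "a 0 \<noteq> ?a i" if "i < r" for i using lt[OF that] by simp
  then have "a 0 \<notin> ?B" using Suc(3)[of 0] by auto
  moreover have "card ?B = card A + r"
    using assms(1) Suc(3) by (subst card_Un_disjoint) (auto simp: card_image[OF inj])
  moreover have "{x \<in> ?B. a 0 < x} = {x \<in> A. a 0 < x}" using lt by fastforce
  ultimately have step: "Y (N + int (card A) + int r - a 0) (wedge N ?B)
      = (- 1) ^ card {x \<in> A. a 0 < x} * wedge N (insert (a 0) ?B)"
    using Y_wedge[of ?B "a 0" N] assms(1) by (simp add: add.assoc)
  have "A \<union> a ` {..<Suc r} = insert (a 0) ?B"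
    by (auto simp: lessThan_Suc_eq_insert_0)
  moreover have "map (\<lambda>i. N + int (card A) + (int (Suc r) - int (Suc i)) - a i) [0..<Suc r]
     = (N + int (card A) + int r - a 0) # map (\<lambda>i. N + int (card A) + (int r - int (Suc i)) - ?a i) [0..<r]"
    by (simp add: map_upt_Suc algebra_simps del: upt_Suc)
  ultimately show ?case
    by (simp only: foldr.simps o_apply IH Y_sign step sum.lessThan_Suc_shift power_add list.map) (simp only: mult_ac)
qed simp

text \<open>The greatest site is removed first. Site \<open>b i\<close> then lacks
  \<open>r - Suc i\<close> of the sites originally above it, which accounts for the additional
  sign.\<close>

lemma foldr_Ystar_wedge:
  assumes "finite A" "\<And>i j. i < j \<Longrightarrow> j < r \<Longrightarrow> b i < b j" "\<And>i. i < r \<Longrightarrow> b i \<in> A" "\<And>i. i < r \<Longrightarrow> N \<le> b i"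
  shows "foldr Ystar (map (\<lambda>i. N + int (card A) - 1 - (int r - int (Suc i)) - b i) [0..<r]) (wedge N A)
    = (- 1) ^ (\<Sum>i<r. card {x \<in> A. b i < x} + (r - Suc i)) * wedge N (A - b ` {..<r})"
  using assms(2,3,4)
proof (induction r arbitrary: b)
  case (Suc r)
  let ?b = "\<lambda>i. b (Suc i)"
  let ?S = "?b ` {..<r}" 
  let ?B = "A - ?S"
  have lt: "b 0 < ?b i" if "i < r" for i using Suc(2)[of 0 "Suc i"] that by simp
  have inj: "inj_on ?b {..<r}"
  proof (rule inj_onI)
    fix i j assume "i \<in> {..<r}" "j \<in> {..<r}" "b (Suc i) = b (Suc j)"
    then show "i = j"
      using Suc(2)[of "Suc i" "Suc j"] Suc(2)[of "Suc j" "Suc i"] by (cases i j rule: linorder_cases) auto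
  qed
  have IH: "foldr Ystar (map (\<lambda>i. N + int (card A) - 1 - (int r - int (Suc i)) - ?b i) [0..<r]) (wedge N A)
    = (- 1) ^ (\<Sum>i<r. card {x \<in> A. ?b i < x} + (r - Suc i)) * wedge N ?B"
    by (rule Suc(1)) (rule Suc(2) Suc(3) Suc(4); simp)+
  have card_S: "card ?S = r" by (simp add: card_image[OF inj])
  have S: "?S \<subseteq> {x \<in> A. b 0 < x}" using lt Suc(3) by auto
  then have c1: "card ?B = card A - r" "r \<le> card A"
    using assms(1) card_S card_mono[of A ?S] card_Diff_subset[of ?S A] by auto
  have "{x \<in> ?B. b 0 < x} = {x \<in> A. b 0 < x} - ?S" by auto
  then have c2: "card {x \<in> ?B. b 0 < x} = card {x \<in> A. b 0 < x} - r" "r \<le> card {x \<in> A. b 0 < x}"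
    using assms(1) card_S card_mono[of "{x \<in> A. b 0 < x}" ?S] S by (auto simp: card_Diff_subset)
  \<comment> \<open>Adding \<open>r\<close> instead of subtracting it keeps the parity and avoids
    truncated subtraction in the exponent.\<close>
  have sgn: "(- 1 :: symfun) ^ card {x \<in> ?B. b 0 < x} = (- 1) ^ (card {x \<in> A. b 0 < x} + r)"
    using c2 by (simp add: minus_one_power_iff)
  have "b 0 \<noteq> ?b i" if "i < r" for i using lt[OF that] by simp
  then have "b 0 \<in> ?B" using Suc(3)[of 0] by auto
  then have step: "Ystar (N + int (card A) - 1 - int r - b 0) (wedge N ?B)
      = (- 1) ^ (card {x \<in> A. b 0 < x} + r) * wedge N (?B - {b 0})"
    using Ystar_wedge[of ?B "b 0" N] assms(1) Suc(4)[of 0] c1 unfolding sgn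
    by (simp add: of_nat_diff algebra_simps)
  have "A - b ` {..<Suc r} = ?B - {b 0}"
    by (auto simp: lessThan_Suc_eq_insert_0)
  moreover have "map (\<lambda>i. N + int (card A) - 1 - (int (Suc r) - int (Suc i)) - b i) [0..<Suc r]
     = (N + int (card A) - 1 - int r - b 0) # map (\<lambda>i. N + int (card A) - 1 - (int r - int (Suc i)) - ?b i) [0..<r]"
    by (simp add: map_upt_Suc algebra_simps del: upt_Suc)
  moreover have "(\<Sum>i<Suc r. card {x \<in> A. b i < x} + (Suc r - Suc i))
     = card {x \<in> A. b 0 < x} + r + (\<Sum>i<r. card {x \<in> A. ?b i < x} + (r - Suc i))"
    by (simp add: sum.lessThan_Suc_shift del: sum.lessThan_Suc)
  ultimately show ?case
    by (simp only: foldr.simps o_apply IH Ystar_sign step power_add) (simp only: mult_ac)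
qed simp

section \<open>Occupied sites of a partition and of its conjugate\<close>

lemma downward_closed_eq_lessThan:
  fixes S :: "nat set"
  assumes "finite S" "\<And>i j. j \<in> S \<Longrightarrow> i < j \<Longrightarrow> i \<in> S"
  shows "S = {..<card S}"
proof -
  define n where "n = (LEAST n. n \<notin> S)"
  have "\<exists>n. n \<notin> S" using assms(1) ex_new_if_finite infinite_UNIV_nat by blast
  then have "n \<notin> S" unfolding n_def by (rule LeastI_ex)
  moreover have "i \<in> S" if "i < n" for i
    using not_less_Least[of i "\<lambda>n. n \<notin> S"] that by (auto simp: n_def)
  ultimately have "i \<in> S \<longleftrightarrow> i < n" for i
    using assms(2)[of i n] by (cases i n rule: linorder_cases) auto
  then have "S = {..<n}" by auto
  then show ?thesis by simp
qed

definition row_sites :: "nat list \<Rightarrow> int set" where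
  "row_sites lam = (\<lambda>i. int (lam ! i) - int i - 1) ` {..<length lam}"

lemma partition_nth_mono: "is_partition lam \<Longrightarrow> i \<le> j \<Longrightarrow> j < length lam \<Longrightarrow> lam ! j \<le> lam ! i"
  unfolding is_partition_def by (cases "i = j") (auto simp: sorted_wrt_iff_nth_less)

text \<open>With bottom level \<open>- int (length lam)\<close> the final charge is 0. The product
  starts from the empty set of sites, so no sign arises.\<close>

lemma sp_eq_wedge:
  assumes "is_partition lam"
  shows "sp lam = wedge (- int (length lam)) (row_sites lam)"
proof -
  let ?k = "length lam" and ?a = "\<lambda>i. int (lam ! i) - int i - 1"
  have "map (\<lambda>l. - int l) lam = map (\<lambda>i. - int ?k + int (card ({} :: int set)) + (int ?k - int (Suc i)) - ?a i) [0..<?k]"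
    by (rule nth_equalityI) simp_all
  moreover have "sp lam = foldr Y (map (\<lambda>l. - int l) lam) 1"
    using assms by (simp add: sp_eq_foldr_Y is_partition_def)
  ultimately have "sp lam = foldr Y (map (\<lambda>i. - int ?k + int (card ({} :: int set)) + (int ?k - int (Suc i)) - ?a i) [0..<?k])
      (wedge (- int ?k) {})"
    by (simp only: wedge_empty)
  also have "\<dots> = (- 1) ^ (\<Sum>i<?k. card {x \<in> {}. ?a i < x}) * wedge (- int ?k) ({} \<union> ?a ` {..<?k})"
  proof (rule foldr_Y_wedge)
    show "?a j < ?a i" if "i < j" "j < ?k" for i j
      using partition_nth_mono[OF assms, of i j] that by simp
  qed simp_all
  also have "\<dots> = wedge (- int ?k) (row_sites lam)"
    unfolding row_sites_def by simp
  finally show ?thesis .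
qed

locale conjugate_partitions =
  fixes lam mu :: "nat list"
  assumes lam: "is_partition lam" and conj: "is_conjugate lam mu"
begin

abbreviation "k \<equiv> length lam"
abbreviation "m \<equiv> length mu"
abbreviation "a i \<equiv> int (lam ! i) - int i - 1"
text \<open>With columns counted from 1 this is j - 1 - \<lambda>'_j; these are the sites that
  \<open>lam\<close> leaves empty below level \<open>m\<close>.\<close>

abbreviation "b j \<equiv> int j - int (mu ! j)"

lemma mu: "is_partition mu"
  using conj by (simp add: is_conjugate_def)

lemma diagram_iff: "i < k \<and> j < lam ! i \<longleftrightarrow> j < m \<and> i < mu ! j"
proof -
  have "(j, i) \<in> diagram mu \<longleftrightarrow> (i, j) \<in> diagram lam"
    using conj by (auto simp: is_conjugate_def)
  then show ?thesis by (auto simp: diagram_def)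
qed

lemma a_less: "i < j \<Longrightarrow> j < k \<Longrightarrow> a j < a i"
  using partition_nth_mono[OF lam, of i j] by simp

lemma b_less: "i < j \<Longrightarrow> j < m \<Longrightarrow> b i < b j"
  using partition_nth_mono[OF mu, of i j] by simp

lemma lam_le: "i < k \<Longrightarrow> lam ! i \<le> m"
  using diagram_iff[of i "lam ! i - 1"] by (cases "lam ! i") auto

lemma mu_le: "j < m \<Longrightarrow> mu ! j \<le> k"
  using diagram_iff[of "mu ! j - 1" j] by (cases "mu ! j") auto

text \<open>For a box of the diagram \<open>a i - b j\<close> is its hook length, hence positive.
  Outside the diagram the difference is negative.\<close>

lemma a_neq_b: "i < k \<Longrightarrow> j < m \<Longrightarrow> a i \<noteq> b j"
  using diagram_iff[of i j] by (cases "j < lam ! i") auto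

lemma inj_a: "inj_on a {..<k}"
proof (rule inj_onI)
  fix i j assume "i \<in> {..<k}" "j \<in> {..<k}" "a i = a j"
  then show "i = j" using a_less[of i j] a_less[of j i] by (cases i j rule: linorder_cases) auto
qed

lemma inj_b: "inj_on b {..<m}"
proof (rule inj_onI)
  fix i j assume "i \<in> {..<m}" "j \<in> {..<m}" "b i = b j"
  then show "i = j" using b_less[of i j] b_less[of j i] by (cases i j rule: linorder_cases) auto
qed

lemma card_row_sites: "card (row_sites lam) = k"
  unfolding row_sites_def card_image[OF inj_a] by simp

text \<open>Disjointness gives one inclusion. Equality follows by counting, as \<open>m\<close> of
  the \<open>k + m\<close> sites are removed.\<close>

lemma row_sites_complement: "{- int k..<int m} - b ` {..<m} = row_sites lam"
proof (rule card_subset_eq[symmetric])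
  have "b ` {..<m} \<subseteq> {- int k..<int m}" using mu_le by fastforce
  then have "card ({- int k..<int m} - b ` {..<m}) = k"
    by (simp add: card_Diff_subset card_image[OF inj_b])
  then show "card (row_sites lam) = card ({- int k..<int m} - b ` {..<m})"
    by (simp add: card_row_sites)
  show "row_sites lam \<subseteq> {- int k..<int m} - b ` {..<m}"
    using a_neq_b lam_le by (fastforce simp: row_sites_def)
qed simp

text \<open>The completely filled interval represents 1. Emptying the sites \<open>b j\<close> by
  the operators \<open>Ystar\<close> leaves the wedge of \<open>sp lam\<close>, and the sign agrees
  with \<open>foldr_Ystar_partition\<close> up to an even exponent.\<close>

lemma sp_eq_e_det: "sp lam = e_det mu"
proof -
  let ?A = "{- int k..<int m}"
  have card_gt: "card {x \<in> ?A. b j < x} = m - Suc j + mu ! j" if "j < m" for j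
  proof -
    have "{x \<in> ?A. b j < x} = {b j<..<int m}" using mu_le[OF that] by auto
    then show ?thesis using that by simp
  qed
  have "map int mu = map (\<lambda>j. - int k + int (card ?A) - 1 - (int m - int (Suc j)) - b j) [0..<m]"
    by (rule nth_equalityI) simp_all
  moreover have "wedge (- int k) ?A = 1" by (rule wedge_interval) simp
  ultimately have "foldr Ystar (map int mu) 1
     = foldr Ystar (map (\<lambda>j. - int k + int (card ?A) - 1 - (int m - int (Suc j)) - b j) [0..<m]) (wedge (- int k) ?A)"
    by simp
  also have "\<dots> = (- 1) ^ (\<Sum>j<m. card {x \<in> ?A. b j < x} + (m - Suc j)) * wedge (- int k) (?A - b ` {..<m})"
  proof (rule foldr_Ystar_wedge)
    show "b i < b j" if "i < j" "j < m" for i j using that by (rule b_less)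
    show "b i \<in> ?A" "- int k \<le> b i" if "i < m" for i using mu_le[OF that] that by auto
  qed simp
  also have "(\<Sum>j<m. card {x \<in> ?A. b j < x} + (m - Suc j)) = (\<Sum>j<m. 2 * (m - Suc j) + mu ! j)"
  proof (rule sum.cong[OF refl])
    fix j assume "j \<in> {..<m}"
    then have "card {x \<in> ?A. b j < x} = m - Suc j + mu ! j" by (simp only: lessThan_iff card_gt)
    then show "card {x \<in> ?A. b j < x} + (m - Suc j) = 2 * (m - Suc j) + mu ! j" by (simp only:)
  qed
  also have "\<dots> = 2 * (\<Sum>j<m. m - Suc j) + sum_list mu"
    by (simp add: sum.distrib sum_distrib_left sum_list_sum_nth atLeast0LessThan)
  finally have "(- 1) ^ sum_list mu * e_det mu = (- 1) ^ sum_list mu * sp lam"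
    by (simp add: foldr_Ystar_partition row_sites_complement sp_eq_wedge[OF lam] power_add)
  then show ?thesis by simp
qed

lemma diagonal: "{i. (i, i) \<in> diagram lam} = {..<diag_length lam}"
  unfolding diag_length_def
proof (rule downward_closed_eq_lessThan)
  show "finite {i. (i, i) \<in> diagram lam}"
    by (rule finite_subset[of _ "{..<k}"]) (auto simp: diagram_def)
  show "i \<in> {i. (i, i) \<in> diagram lam}" if "j \<in> {i. (i, i) \<in> diagram lam}" "i < j" for i j
    using that partition_nth_mono[OF lam, of i j] by (auto simp: diagram_def)
qed

text \<open>The sites below 0 represent 1 at charge 0. The diagonal hooks say which \<open>r\<close>
  of them are emptied and which \<open>r\<close> sites from 0 on are filled, and the two formulas do
  this in opposite orders. In the second, the removal at \<open>b i\<close> acts at charge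
  \<open>Suc i\<close>, which makes its index \<open>beta ! i + Suc i\<close>. With
  \<open>beta ! i - Suc i\<close> instead, the partition (1) would give
  \<open>Ystar (- 1) (Y 0 1) = 0\<close>, whereas its \<open>sp\<close> is
  \<open>psum 1\<close>.\<close>

lemma frobenius_formulas:
  defines "r \<equiv> diag_length lam"
  defines "alpha \<equiv> map (\<lambda>i. lam ! i - Suc i) [0..<r]"
  defines "beta \<equiv> map (\<lambda>i. mu ! i - Suc i) [0..<r]"
  shows "sp lam = (- 1) ^ (sum_list beta + r * (r - 1) div 2) *
              foldr Y (map (\<lambda>i. - int (alpha ! i) - int (Suc i)) [0..<r])
                (foldr Ystar (map (\<lambda>i. int (beta ! i) - (int r - int (Suc i))) [0..<r]) 1)" (is ?first)
    and "sp lam = (- 1) ^ (sum_list beta + r * (r + 1) div 2) *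
              foldr Ystar (map (\<lambda>i. int (beta ! i) + int (Suc i)) [0..<r])
                (foldr Y (map (\<lambda>i. - int (alpha ! i) + (int r - int (Suc i))) [0..<r]) 1)" (is ?second)
proof -
  let ?N = "- int k" and ?V = "{- int k..<0}"
  have diag: "i < r \<longleftrightarrow> i < k \<and> i < lam ! i" for i
    using diagonal by (auto simp: r_def diagram_def set_eq_iff)
  have diag': "i < m" "i < mu ! i" if "i < r" for i
    using diag[of i] diagram_iff[of i i] that by auto
  have alpha: "int (alpha ! i) = a i" "0 \<le> a i" if "i < r" for i
    using diag[of i] that by (auto simp: alpha_def of_nat_diff)
  have beta: "int (beta ! i) = - 1 - b i" "b i < 0" "- int k \<le> b i" if "i < r" for i
    using diag'[OF that] mu_le[of i] that by (auto simp: beta_def of_nat_diff)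
  have a_less': "a j < a i" if "i < j" "j < r" for i j using a_less[of i j] that diag[of j] by simp
  have b_less': "b i < b j" if "i < j" "j < r" for i j using b_less[of i j] that diag'[of j] by simp
  have V: "card ?V = k" "wedge ?N ?V = 1" by (simp_all add: wedge_interval)
  have r_le: "r \<le> k" using diag[of "r - 1"] by (cases r) auto
  have r_le': "r \<le> m" using diag'(1)[of "r - 1"] by (cases r) auto
  have a_V: "a i \<notin> ?V" if "i < r" for i using alpha(2)[OF that] by simp
  have inj_a': "inj_on a {..<r}" and inj_b': "inj_on b {..<r}"
    by (rule inj_on_subset[OF inj_a], use r_le in auto, rule inj_on_subset[OF inj_b], use r_le' in auto)
  have b_V: "b ` {..<r} \<subseteq> ?V" using beta by auto
  have card_b: "card (b ` {..<r}) = r" and card_a: "card (a ` {..<r}) = r"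
    by (simp_all add: card_image inj_a' inj_b')
  have card_Vb: "card (?V - b ` {..<r}) = k - r"
    using b_V by (simp add: card_Diff_subset card_b)
  have card_Va: "card (?V \<union> a ` {..<r}) = k + r"
    using a_V by (subst card_Un_disjoint) (auto simp: card_a)
  \<comment> \<open>Rows beyond the diagonal have negative \<open>a i\<close> and already lie in
    \<open>?V\<close>, away from the removed sites. Counting then gives equality.\<close>
  have sites: "(?V - b ` {..<r}) \<union> a ` {..<r} = row_sites lam"
  proof (rule card_subset_eq[symmetric])
    have "card ((?V - b ` {..<r}) \<union> a ` {..<r}) = k"
      using a_V r_le by (subst card_Un_disjoint) (auto simp: card_a card_Vb)
    then show "card (row_sites lam) = card ((?V - b ` {..<r}) \<union> a ` {..<r})" by (simp add: card_row_sites)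
    show "row_sites lam \<subseteq> (?V - b ` {..<r}) \<union> a ` {..<r}"
    proof
      fix x assume "x \<in> row_sites lam"
      then obtain i where i: "i < k" "x = a i" by (auto simp: row_sites_def)
      show "x \<in> (?V - b ` {..<r}) \<union> a ` {..<r}"
      proof (cases "i < r")
        case False
        then have "a i \<in> ?V" using diag[of i] i(1) by auto
        moreover have "a i \<notin> b ` {..<r}" using a_neq_b[OF i(1)] diag'(1) by blast
        ultimately show ?thesis unfolding i(2) by (intro UnI1 DiffI)
      qed (use i in auto)
    qed
  qed simp
  have sum_beta: "sum_list beta = (\<Sum>i<r. beta ! i)"
    by (simp add: sum_list_sum_nth beta_def atLeast0LessThan)
  have gauss: "(\<Sum>i<r. r - Suc i) = r * (r - 1) div 2"
    using sum.nat_diff_reindex[of "\<lambda>i. i" r] Sum_Ico_nat[of 0 r] by (simp add: atLeast0LessThan)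
  have e1: "map (\<lambda>i. int (beta ! i) - (int r - int (Suc i))) [0..<r]
      = map (\<lambda>i. ?N + int (card ?V) - 1 - (int r - int (Suc i)) - b i) [0..<r]"
    by (rule map_cong) (use beta V in auto)
  have "foldr Ystar (map (\<lambda>i. int (beta ! i) - (int r - int (Suc i))) [0..<r]) 1
      = foldr Ystar (map (\<lambda>i. ?N + int (card ?V) - 1 - (int r - int (Suc i)) - b i) [0..<r]) (wedge ?N ?V)"
    by (simp only: e1 V)
  also have "\<dots> = (- 1) ^ (\<Sum>i<r. card {x \<in> ?V. b i < x} + (r - Suc i)) * wedge ?N (?V - b ` {..<r})"
  proof (rule foldr_Ystar_wedge)
    show "b i < b j" if "i < j" "j < r" for i j using that by (rule b_less')
    show "b i \<in> ?V" "- int k \<le> b i" if "i < r" for i using beta[OF that] by auto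
  qed simp
  also have "(\<Sum>i<r. card {x \<in> ?V. b i < x} + (r - Suc i)) = (\<Sum>i<r. beta ! i + (r - Suc i))"
  proof (rule sum.cong[OF refl])
    fix i assume "i \<in> {..<r}"
    then have i: "i < r" by simp
    have "{x \<in> ?V. b i < x} = {b i<..<0}" using beta(3)[OF i] by auto
    then show "card {x \<in> ?V. b i < x} + (r - Suc i) = beta ! i + (r - Suc i)"
      using beta(1)[OF i] by simp
  qed
  also have "\<dots> = sum_list beta + r * (r - 1) div 2"
    by (simp only: sum.distrib sum_beta gauss)
  finally have s1: "foldr Ystar (map (\<lambda>i. int (beta ! i) - (int r - int (Suc i))) [0..<r]) 1
      = (- 1) ^ (sum_list beta + r * (r - 1) div 2) * wedge ?N (?V - b ` {..<r})" .
  have foldr_Y_sign: "foldr Y xs ((- 1) ^ n * f) = (- 1) ^ n * foldr Y xs f" for xs n f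
    by (induction xs) (simp_all add: Y_sign)
  have e2: "map (\<lambda>i. - int (alpha ! i) - int (Suc i)) [0..<r]
      = map (\<lambda>i. ?N + int (card (?V - b ` {..<r})) + (int r - int (Suc i)) - a i) [0..<r]"
    by (rule map_cong) (use alpha card_Vb r_le in \<open>auto simp: of_nat_diff\<close>)
  have "foldr Y (map (\<lambda>i. - int (alpha ! i) - int (Suc i)) [0..<r]) (wedge ?N (?V - b ` {..<r}))
      = (- 1) ^ (\<Sum>i<r. card {x \<in> ?V - b ` {..<r}. a i < x}) * wedge ?N (?V - b ` {..<r} \<union> a ` {..<r})"
    unfolding e2
  proof (rule foldr_Y_wedge)
    show "a j < a i" if "i < j" "j < r" for i j using that by (rule a_less')
    show "a i \<notin> ?V - b ` {..<r}" if "i < r" for i using a_V[OF that] by blast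
  qed simp
  \<comment> \<open>All \<open>a i\<close> are nonnegative, so nothing in \<open>?V\<close> is
    crossed.\<close>
  also have "(\<Sum>i<r. card {x \<in> ?V - b ` {..<r}. a i < x}) = 0"
  proof (rule sum.neutral, rule ballI)
    fix i assume "i \<in> {..<r}"
    then have "{x \<in> ?V - b ` {..<r}. a i < x} = {}" using alpha(2)[of i] by auto
    then show "card {x \<in> ?V - b ` {..<r}. a i < x} = 0" by (simp only: card.empty)
  qed
  finally have "foldr Y (map (\<lambda>i. - int (alpha ! i) - int (Suc i)) [0..<r]) (wedge ?N (?V - b ` {..<r})) = sp lam"
    by (simp only: sites sp_eq_wedge[OF lam] power_0 mult_1)
  then show ?first
    by (simp only: s1 foldr_Y_sign mult.assoc[symmetric] power_add[symmetric]) (simp add: minus_one_power_iff)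
  have e3: "map (\<lambda>i. - int (alpha ! i) + (int r - int (Suc i))) [0..<r]
      = map (\<lambda>i. ?N + int (card ?V) + (int r - int (Suc i)) - a i) [0..<r]"
    by (rule map_cong) (use alpha V in auto)
  have "foldr Y (map (\<lambda>i. - int (alpha ! i) + (int r - int (Suc i))) [0..<r]) 1
      = foldr Y (map (\<lambda>i. ?N + int (card ?V) + (int r - int (Suc i)) - a i) [0..<r]) (wedge ?N ?V)"
    by (simp only: e3 V)
  also have "\<dots> = (- 1) ^ (\<Sum>i<r. card {x \<in> ?V. a i < x}) * wedge ?N (?V \<union> a ` {..<r})"
  proof (rule foldr_Y_wedge)
    show "a j < a i" if "i < j" "j < r" for i j using that by (rule a_less')
    show "a i \<notin> ?V" if "i < r" for i using that by (rule a_V)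
  qed simp
  also have "(\<Sum>i<r. card {x \<in> ?V. a i < x}) = 0"
  proof (rule sum.neutral, rule ballI)
    fix i assume "i \<in> {..<r}"
    then have "{x \<in> ?V. a i < x} = {}" using alpha(2)[of i] by auto
    then show "card {x \<in> ?V. a i < x} = 0" by (simp only: card.empty)
  qed
  finally have s2: "foldr Y (map (\<lambda>i. - int (alpha ! i) + (int r - int (Suc i))) [0..<r]) 1 = wedge ?N (?V \<union> a ` {..<r})"
    by simp
  let ?W = "?V \<union> a ` {..<r}"
  have e4: "map (\<lambda>i. int (beta ! i) + int (Suc i)) [0..<r]
      = map (\<lambda>i. ?N + int (card ?W) - 1 - (int r - int (Suc i)) - b i) [0..<r]"
    by (rule map_cong) (use beta card_Va in auto)
  have "foldr Ystar (map (\<lambda>i. int (beta ! i) + int (Suc i)) [0..<r]) (wedge ?N ?W)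
      = (- 1) ^ (\<Sum>i<r. card {x \<in> ?W. b i < x} + (r - Suc i)) * wedge ?N (?W - b ` {..<r})"
    unfolding e4
  proof (rule foldr_Ystar_wedge)
    show "b i < b j" if "i < j" "j < r" for i j using that by (rule b_less')
    show "b i \<in> ?W" "- int k \<le> b i" if "i < r" for i using beta[OF that] by auto
  qed simp
  \<comment> \<open>Each removal now crosses the \<open>r\<close> filled sites as well. In total
    this adds \<open>r * r\<close>, of the same parity as \<open>r\<close>, and turns
    \<open>r * (r - 1) div 2\<close> into \<open>r * (r + 1) div 2\<close> modulo 2.\<close>
  also have "(\<Sum>i<r. card {x \<in> ?W. b i < x} + (r - Suc i)) = (\<Sum>i<r. beta ! i + r + (r - Suc i))"
  proof (rule sum.cong[OF refl])
    fix i assume "i \<in> {..<r}"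
    then have i: "i < r" by simp
    have "{x \<in> ?W. b i < x} = {b i<..<0} \<union> a ` {..<r}"
      using beta(2,3)[OF i] alpha(2) by force
    moreover have "{b i<..<0} \<inter> a ` {..<r} = {}" using alpha(2) by force
    ultimately have "card {x \<in> ?W. b i < x} = card {b i<..<0} + r"
      by (simp add: card_Un_disjoint card_a)
    then show "card {x \<in> ?W. b i < x} + (r - Suc i) = beta ! i + r + (r - Suc i)"
      using beta(1)[OF i] by simp
  qed
  also have "\<dots> = sum_list beta + r * (r - 1) div 2 + r * r"
    by (simp only: sum.distrib sum_beta gauss) simp
  also have "?W - b ` {..<r} = row_sites lam"
  proof -
    have "a ` {..<r} \<inter> b ` {..<r} = {}" using alpha(2) beta(2) by force
    then show ?thesis using sites by blast
  qed
  finally have s3: "foldr Ystar (map (\<lambda>i. int (beta ! i) + int (Suc i)) [0..<r]) (wedge ?N ?W)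
      = (- 1) ^ (sum_list beta + r * (r - 1) div 2 + r * r) * sp lam"
    by (simp only: sp_eq_wedge[OF lam])
  have "r * (r + 1) div 2 = r * (r - 1) div 2 + r"
  proof (cases r)
    case (Suc n)
    have "r * (r + 1) = r * (r - 1) + r * 2" using Suc by simp
    then show ?thesis by simp
  qed simp
  then have ev: "even (sum_list beta + r * (r + 1) div 2 + (sum_list beta + r * (r - 1) div 2 + r * r))"
    by auto
  have "(- 1) ^ (sum_list beta + r * (r + 1) div 2) * (- 1) ^ (sum_list beta + r * (r - 1) div 2 + r * r) = (1 :: symfun)"
    unfolding power_add[symmetric] by (rule neg_one_even_power[OF ev])
  then show ?second
    by (simp only: s2 s3 mult.assoc[symmetric] mult_1)
qed

end

theorem theorem4p3:
  shows "(\<forall>lam. is_partition lam \<longrightarrow>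
            foldr Ystar (map int lam) 1 = (-1) ^ sum_list lam * e_det lam)
       \<and> (\<forall>lam mu. is_partition lam \<and> is_conjugate lam mu \<longrightarrow> sp lam = e_det mu)
       \<and> (\<forall>lam alpha beta r. is_partition lam \<and> frobenius lam alpha beta \<and> r = length alpha \<longrightarrow>
            sp lam = (-1) ^ (sum_list beta + r * (r - 1) div 2) *
              foldr Y (map (\<lambda>i. - int (alpha ! i) - int (Suc i)) [0..<r])
                (foldr Ystar (map (\<lambda>i. int (beta ! i) - (int r - int (Suc i))) [0..<r]) 1)
          \<and> sp lam = (-1) ^ (sum_list beta + r * (r + 1) div 2) *
              foldr Ystar (map (\<lambda>i. int (beta ! i) + int (Suc i)) [0..<r])
                (foldr Y (map (\<lambda>i. - int (alpha ! i) + (int r - int (Suc i))) [0..<r]) 1))"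
proof (intro conjI allI impI; (elim conjE)?)
  fix lam
  show "foldr Ystar (map int lam) 1 = (-1) ^ sum_list lam * e_det lam"
    by (rule foldr_Ystar_partition)
next
  fix lam mu
  assume "is_partition lam" "is_conjugate lam mu"
  then interpret conjugate_partitions lam mu by unfold_locales
  show "sp lam = e_det mu" by (rule sp_eq_e_det)
next
  fix lam alpha beta r
  assume lam: "is_partition lam" and frob: "frobenius lam alpha beta" and r: "r = length alpha"
  then obtain mu where mu: "is_conjugate lam mu"
    and alpha: "alpha = map (\<lambda>i. lam ! i - Suc i) [0..<diag_length lam]"
    and beta: "beta = map (\<lambda>i. mu ! i - Suc i) [0..<diag_length lam]"
    unfolding frobenius_def by blast
  interpret conjugate_partitions lam mu using lam mu by unfold_locales
  have r': "r = diag_length lam" by (simp add: r alpha)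
  show "sp lam = (-1) ^ (sum_list beta + r * (r - 1) div 2) *
      foldr Y (map (\<lambda>i. - int (alpha ! i) - int (Suc i)) [0..<r])
        (foldr Ystar (map (\<lambda>i. int (beta ! i) - (int r - int (Suc i))) [0..<r]) 1)"
    unfolding r' alpha beta by (rule frobenius_formulas(1))
  show "sp lam = (-1) ^ (sum_list beta + r * (r + 1) div 2) *
      foldr Ystar (map (\<lambda>i. int (beta ! i) + int (Suc i)) [0..<r])
        (foldr Y (map (\<lambda>i. - int (alpha ! i) + (int r - int (Suc i))) [0..<r]) 1)"
    unfolding r' alpha beta by (rule frobenius_formulas(2))
qed

end
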